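(* For each $2\le k<\omega$, $(\mathcal{E}_k,\le,r)$ is a topological Ramsey space.
   Context: Let $\omega^{\not\downarrow\le k}$ be the set of non-decreasing sequences of natural numbers of length $\le k$ (including $()$), $\omega^{\not\downarrow k}$ those of length exactly $k$. Well-order $\omega^{\not\downarrow\le k}$ by $\prec$: $()$ is least, and for nonempty $(j_0,\dots,j_{p-1}),(l_0,\dots,l_{q-1})$, $(j_0,\dots,j_{p-1})\prec(l_0,\dots,l_{q-1})$ iff $j_{p-1}<l_{q-1}$, or $j_{p-1}=l_{q-1}$ and $(j_0,\dots,j_{p-1})$ is lexicographically below $(l_0,\dots,l_{q-1})$ (a proper initial segment counts as below). This has order type $\omega$; $\vec j_m$ is its $m$-th element, $m_{\vec l}$ the index of $\vec l$, and $\vec i_n$ the $n$-th element of $\omega^{\not\downarrow k}$ under $\prec$. Put $\mathbb{W}_k(\vec j)=\{m_{\vec j\restriction q}:1\le q\le|\vec j|\}$, $\widehat{\mathbb{W}}_k=\{\mathbb{W}_k(\vec j):\vec j\in\omega^{\not\downarrow\le k}\}$, $\mathbb{W}_k=\{\mathbb{W}_k(\vec i):\vec i\in\omega^{\not\downarrow k}\}\subseteq[\omega]^k$. An $\mathcal{E}_k$-tree is $\hat X:\omega^{\not\downarrow\le k}\to\widehat{\mathbb{W}}_k$ with (i) $|\hat X(\vec j_m)|=|\vec j_m|$; (ii) $\max\hat X(\vec j_m)<\max\hat X(\vec j_{m+1})$ for all $m\ge1$; (iii) for all $m,n$, $\hat X(\vec j_m)$ is a proper initial segment of $\hat X(\vec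 j_n)$ (finite sets listed increasingly) iff $\vec j_m$ is a proper initial segment of $\vec j_n$. $\mathcal{E}_k$ is the set of all $X=\hat X\restriction\omega^{\not\downarrow k}$ for $\mathcal{E}_k$-trees $\hat X$; $X$ is identified with its range. $Y\le X$ iff $\mathrm{ran}(Y)\subseteq\mathrm{ran}(X)$. $r_n(X)=X\restriction\{\vec i_p:p<n\}$; $\mathcal{AR}_n=\{r_n(X):X\in\mathcal{E}_k\}$, $\mathcal{AR}=\bigcup_n\mathcal{AR}_n$. For $a\in\mathcal{AR}$ and $B\in\mathcal{E}_k$, $[a,B]=\{A\in\mathcal{E}_k:A\le B\text{ and }r_n(A)=a\text{ for some }n\}$. The Ellentuck topology on $\mathcal{E}_k$ is generated by the sets $[a,B]$. A set $\mathcal{X}\subseteq\mathcal{E}_k$ is Ramsey if for every nonempty $[a,A]$ there is $B\in[a,A]$ with $[a,B]\subseteq\mathcal{X}$ or $[a,B]\cap\mathcal{X}=\emptyset$; it is Ramsey null if for every nonempty $[a,A]$ there is $B\in[a,A]$ with $[a,B]\cap\mathcal{X}=\emptyset$. $(\mathcal{E}_k,\le,r)$ is a topological Ramsey space if every subset with the property of Baire (in the Ellentuck topology) is Ramsey and every meager subset is Ramsey null. *)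

theory Defs
  imports "HOL-Analysis.Analysis" "HOL-Library.Sublist"
begin

section \<open>Topological Ramsey spaces\<close>

definition nowhere_dense_in :: "'a topology \<Rightarrow> 'a set \<Rightarrow> bool" where
  "nowhere_dense_in T S \<longleftrightarrow> S \<subseteq> topspace T \<and> T interior_of (T closure_of S) = {}"

definition meager_in :: "'a topology \<Rightarrow> 'a set \<Rightarrow> bool" where
  "meager_in T S \<longleftrightarrow> (\<exists>N :: nat \<Rightarrow> 'a set. (\<forall>n. nowhere_dense_in T (N n)) \<and> S = (\<Union>n. N n))"

definition baire_property_in :: "'a topology \<Rightarrow> 'a set \<Rightarrow> bool" where
  "baire_property_in T S \<longleftrightarrow>
     S \<subseteq> topspace T \<and> (\<exists>U. openin T U \<and> meager_in T (sym_diff S U))"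

text \<open>In the following, \<open>R\<close> is the set of points, \<open>le\<close> the quasi-order on it and
  \<open>r n A\<close> the \<open>n\<close>-th approximation of \<open>A\<close>.\<close>

definition approximations :: "'a set \<Rightarrow> (nat \<Rightarrow> 'a \<Rightarrow> 'b) \<Rightarrow> 'b set" where
  "approximations R r = (\<Union>n. r n ` R)"

definition basic_set ::
    "'a set \<Rightarrow> ('a \<Rightarrow> 'a \<Rightarrow> bool) \<Rightarrow> (nat \<Rightarrow> 'a \<Rightarrow> 'b) \<Rightarrow> 'b \<Rightarrow> 'a \<Rightarrow> 'a set" where
  "basic_set R le r a B = {A \<in> R. le A B \<and> (\<exists>n. r n A = a)}"

definition ellentuck_topology ::
    "'a set \<Rightarrow> ('a \<Rightarrow> 'a \<Rightarrow> bool) \<Rightarrow> (nat \<Rightarrow> 'a \<Rightarrow> 'b) \<Rightarrow> 'a topology" where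
  "ellentuck_topology R le r =
     topology_generated_by {basic_set R le r a B | a B. a \<in> approximations R r \<and> B \<in> R}"

definition ramsey ::
    "'a set \<Rightarrow> ('a \<Rightarrow> 'a \<Rightarrow> bool) \<Rightarrow> (nat \<Rightarrow> 'a \<Rightarrow> 'b) \<Rightarrow> 'a set \<Rightarrow> bool" where
  "ramsey R le r \<X> \<longleftrightarrow>
     (\<forall>a \<in> approximations R r. \<forall>A \<in> R. basic_set R le r a A \<noteq> {} \<longrightarrow>
        (\<exists>B \<in> basic_set R le r a A.
           basic_set R le r a B \<subseteq> \<X> \<or> basic_set R le r a B \<inter> \<X> = {}))"

definition ramsey_null ::
    "'a set \<Rightarrow> ('a \<Rightarrow> 'a \<Rightarrow> bool) \<Rightarrow> (nat \<Rightarrow> 'a \<Rightarrow> 'b) \<Rightarrow> 'a set \<Rightarrow> bool" where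
  "ramsey_null R le r \<X> \<longleftrightarrow>
     (\<forall>a \<in> approximations R r. \<forall>A \<in> R. basic_set R le r a A \<noteq> {} \<longrightarrow>
        (\<exists>B \<in> basic_set R le r a A. basic_set R le r a B \<inter> \<X> = {}))"

definition topological_ramsey_space ::
    "'a set \<Rightarrow> ('a \<Rightarrow> 'a \<Rightarrow> bool) \<Rightarrow> (nat \<Rightarrow> 'a \<Rightarrow> 'b) \<Rightarrow> bool" where
  "topological_ramsey_space R le r \<longleftrightarrow>
     (\<forall>\<X> \<subseteq> R. baire_property_in (ellentuck_topology R le r) \<X> \<longrightarrow> ramsey R le r \<X>) \<and>
     (\<forall>\<X> \<subseteq> R. meager_in (ellentuck_topology R le r) \<X> \<longrightarrow> ramsey_null R le r \<X>)"


section \<open>The spaces \<open>\<E>\<^sub>k\<close>\<close>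

definition nondec_le :: "nat \<Rightarrow> nat list set" where
  "nondec_le k = {j. sorted j \<and> length j \<le> k}"

definition nondec_eq :: "nat \<Rightarrow> nat list set" where
  "nondec_eq k = {j. sorted j \<and> length j = k}"

text \<open>\<open>lexord\<close> puts every proper initial segment of a list below that list.\<close>

definition prec :: "nat list \<Rightarrow> nat list \<Rightarrow> bool" where
  "prec j l \<longleftrightarrow>
     (j = [] \<and> l \<noteq> []) \<or>
     (j \<noteq> [] \<and> l \<noteq> [] \<and>
       (last j < last l \<or> (last j = last l \<and> (j, l) \<in> lexord less_than)))"

definition prec_index :: "nat list set \<Rightarrow> nat list \<Rightarrow> nat" where
  "prec_index S l = card {j \<in> S. prec j l}"

text \<open>The \<open>m\<close>-th element of \<open>S\<close> under \<open>prec\<close>, counting from 0. The description is proper for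
  \<open>S = nondec_le k\<close> and \<open>S = nondec_eq k\<close> with \<open>k \<ge> 1\<close>, which have order type \<open>\<omega>\<close>
  (see \<open>bij_betw_prec_nth\<close> below).\<close>

definition prec_nth :: "nat list set \<Rightarrow> nat \<Rightarrow> nat list" where
  "prec_nth S m = (THE l. l \<in> S \<and> prec_index S l = m)"

definition W_set :: "nat \<Rightarrow> nat list \<Rightarrow> nat set" where
  "W_set k j = {prec_index (nondec_le k) (take q j) | q. 1 \<le> q \<and> q \<le> length j}"

definition W_hat :: "nat \<Rightarrow> nat set set" where
  "W_hat k = W_set k ` nondec_le k"

definition set_strict_prefix :: "nat set \<Rightarrow> nat set \<Rightarrow> bool" where
  "set_strict_prefix A B \<longleftrightarrow> strict_prefix (sorted_list_of_set A) (sorted_list_of_set B)"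

text \<open>Only the values of \<open>f\<close> on \<open>nondec_le k\<close> matter.\<close>

definition E_tree :: "nat \<Rightarrow> (nat list \<Rightarrow> nat set) \<Rightarrow> bool" where
  "E_tree k f \<longleftrightarrow>
     f \<in> nondec_le k \<rightarrow> W_hat k \<and>
     (\<forall>m. card (f (prec_nth (nondec_le k) m)) = length (prec_nth (nondec_le k) m)) \<and>
     (\<forall>m \<ge> 1. Max (f (prec_nth (nondec_le k) m)) < Max (f (prec_nth (nondec_le k) (Suc m)))) \<and>
     (\<forall>m n. set_strict_prefix (f (prec_nth (nondec_le k) m)) (f (prec_nth (nondec_le k) n)) \<longleftrightarrow>
            strict_prefix (prec_nth (nondec_le k) m) (prec_nth (nondec_le k) n))"

text \<open>Members of \<open>\<E>\<^sub>k\<close> are functions with domain exactly \<open>nondec_eq k\<close>, and their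
  approximations are functions with finite domain; both are rendered as partial maps,
  so that the domain is part of the object.\<close>

definition E_space :: "nat \<Rightarrow> (nat list \<rightharpoonup> nat set) set" where
  "E_space k = {(\<lambda>j. Some (f j)) |` nondec_eq k | f. E_tree k f}"

definition E_le :: "(nat list \<rightharpoonup> nat set) \<Rightarrow> (nat list \<rightharpoonup> nat set) \<Rightarrow> bool" where
  "E_le Y X \<longleftrightarrow> ran Y \<subseteq> ran X"

definition E_approx :: "nat \<Rightarrow> nat \<Rightarrow> (nat list \<rightharpoonup> nat set) \<Rightarrow> (nat list \<rightharpoonup> nat set)" where
  "E_approx k n X = X |` {prec_nth (nondec_eq k) p | p. p < n}"


section \<open>Well-definedness of the enumerations\<close>

lemma prec_irrefl: "\<not> prec j j"
  by (auto simp: prec_def lexord_irreflexive)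

lemma prec_trans: "prec j l \<Longrightarrow> prec l i \<Longrightarrow> prec j i"
  unfolding prec_def using lexord_trans[OF _ _ trans_less_than, of j l i] by auto

lemma prec_linear: "prec j l \<or> j = l \<or> prec l j"
proof -
  have "(j, l) \<in> lexord less_than \<or> j = l \<or> (l, j) \<in> lexord less_than"
    by (rule lexord_linear) auto
  then show ?thesis unfolding prec_def by (metis linorder_less_linear)
qed

lemma finite_prec_below:
  assumes "S \<subseteq> nondec_le k"
  shows "finite {j \<in> S. prec j l}"
proof (rule finite_subset)
  show "{j \<in> S. prec j l} \<subseteq> insert [] {xs. set xs \<subseteq> {..last l} \<and> length xs \<le> k}"
  proof
    fix j assume j: "j \<in> {j \<in> S. prec j l}"
    then have s: "sorted j" "length j \<le> k" using assms by (auto simp: nondec_le_def)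
    show "j \<in> insert [] {xs. set xs \<subseteq> {..last l} \<and> length xs \<le> k}"
    proof (cases "j = []")
      case False
      then have "last j \<le> last l" using j by (auto simp: prec_def)
      moreover have "x \<le> last j" if "x \<in> set j" for x
        using s(1) that False
        by (metis append_butlast_last_id in_set_conv_decomp list.set_intros(1)
            order_refl rotate1.simps(2) set_ConsD set_rotate1 sorted_append)
      ultimately show ?thesis using s by force
    qed simp
  qed
  show "finite (insert [] {xs. set xs \<subseteq> {..last l} \<and> length xs \<le> k})"
    by (simp add: finite_lists_length_le)
qed

lemma prec_index_strict_mono:
  assumes "S \<subseteq> nondec_le k" "j \<in> S" "prec j l"
  shows "prec_index S j < prec_index S l"
  unfolding prec_index_def
proof (rule psubset_card_mono)
  show "finite {i \<in> S. prec i l}" using finite_prec_below[OF assms(1)] .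
  show "{i \<in> S. prec i j} \<subset> {i \<in> S. prec i l}"
    using assms prec_trans prec_irrefl by blast
qed

lemma prec_index_inj:
  assumes "S \<subseteq> nondec_le k"
  shows "inj_on (prec_index S) S"
proof (rule inj_onI)
  fix j l assume "j \<in> S" "l \<in> S" "prec_index S j = prec_index S l"
  then show "j = l"
    using prec_linear[of j l] prec_index_strict_mono[OF assms] by (metis less_irrefl)
qed

lemma prec_index_downward:
  assumes "S \<subseteq> nondec_le k" "l \<in> S" "m < prec_index S l"
  shows "m \<in> prec_index S ` S"
proof -
  let ?D = "{j \<in> S. prec j l}"
  have "prec_index S ` ?D \<subseteq> {..<prec_index S l}"
    using prec_index_strict_mono[OF assms(1)] by auto
  moreover have "card (prec_index S ` ?D) = card {..<prec_index S l}"
    using card_image[OF inj_on_subset[OF prec_index_inj[OF assms(1)]], of ?D]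
    by (auto simp: prec_index_def)
  ultimately have "prec_index S ` ?D = {..<prec_index S l}"
    by (intro card_subset_eq) auto
  then show ?thesis using assms(3) by blast
qed

lemma bij_betw_prec_index:
  assumes "S \<subseteq> nondec_le k" "infinite S"
  shows "bij_betw (prec_index S) S UNIV"
proof -
  have inj: "inj_on (prec_index S) S" by (rule prec_index_inj[OF assms(1)])
  have "m \<in> prec_index S ` S" for m
  proof -
    have "infinite (prec_index S ` S)" using assms(2) inj finite_imageD by blast
    then obtain n where "n \<in> prec_index S ` S" "m < n"
      using infinite_nat_iff_unbounded by blast
    then show ?thesis using prec_index_downward[OF assms(1)] by blast
  qed
  then show ?thesis using inj by (auto simp: bij_betw_def)
qed

lemma infinite_nondec_eq:
  assumes "1 \<le> k"
  shows "infinite (nondec_eq k)"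
proof
  assume "finite (nondec_eq k)"
  moreover have "range (replicate k) \<subseteq> nondec_eq k" by (auto simp: nondec_eq_def)
  ultimately have "finite (range (replicate k :: nat \<Rightarrow> nat list))" by (rule rev_finite_subset)
  moreover have "inj (replicate k :: nat \<Rightarrow> nat list)" using assms by (auto simp: inj_def)
  ultimately show False using finite_imageD by blast
qed

lemma nondec_eq_subset: "nondec_eq k \<subseteq> nondec_le k"
  by (auto simp: nondec_eq_def nondec_le_def)

lemma infinite_nondec_le: "1 \<le> k \<Longrightarrow> infinite (nondec_le k)"
  using infinite_nondec_eq nondec_eq_subset finite_subset by blast

lemma prec_nth_index:
  assumes "S \<subseteq> nondec_le k" "l \<in> S"
  shows "prec_nth S (prec_index S l) = l"
  unfolding prec_nth_def using assms prec_index_inj[OF assms(1)]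
  by (intro the_equality) (auto dest: inj_onD)

lemma bij_betw_prec_nth:
  assumes "S \<subseteq> nondec_le k" "infinite S"
  shows "bij_betw (prec_nth S) UNIV S"
    and "prec_index S (prec_nth S m) = m"
    and "prec (prec_nth S m) (prec_nth S n) \<longleftrightarrow> m < n"
proof -
  note bij = bij_betw_prec_index[OF assms]
  have *: "prec_nth S m \<in> S \<and> prec_index S (prec_nth S m) = m" for m
  proof -
    obtain l where "l \<in> S" "m = prec_index S l" using bij by (auto simp: bij_betw_def)
    then show ?thesis using prec_nth_index[OF assms(1)] by auto
  qed
  show "bij_betw (prec_nth S) UNIV S"
    by (rule bij_betw_byWitness[where f' = "prec_index S"])
      (use * prec_nth_index[OF assms(1)] in auto)
  show "prec_index S (prec_nth S m) = m" using * by blast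
  show "prec (prec_nth S m) (prec_nth S n) \<longleftrightarrow> m < n"
    using * prec_linear[of "prec_nth S m" "prec_nth S n"]
      prec_index_strict_mono[OF assms(1)] by (metis less_asym less_irrefl)
qed

end

theory Submission
  imports Defs "HOL-Library.Ramsey"
begin

text \<open>
  Since \<open>W_set\<close> is injective and turns prefixes into initial segments, a member of \<open>\<E>\<^sub>k\<close> amounts to
  an embedding of the tree of non-decreasing sequences of length at most \<open>k\<close> into itself that
  preserves length, prefixes and \<open>prec\<close>, and \<open>Y \<le> X\<close> means that the embedding of \<open>Y\<close> factors through
  that of \<open>X\<close>. Factoring out \<open>X\<close>, amalgamation and the pigeonhole principle only have to be shown below
  the identity. There they come from one greedy construction along \<open>prec\<close>: keep a finite part of the
  tree fixed and choose the last entry of each new node larger than everything so far, from a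
  prescribed infinite set depending on the image of its parent. For the pigeonhole principle this set is
  homogeneous in the sense of Ramsey's theorem for the colouring of the possible one-step extensions.
  The topological conclusion is then Todorcevic's abstract Ellentuck theorem, proved by
  combinatorial forcing (accepting and rejecting approximations) and fusion.
\<close>

section \<open>An abstract Ellentuck theorem\<close>

text \<open>The neighbourhood usually written \<open>[d, B]\<close>: by \<open>approx_length\<close>
  it is the basic set of \<open>r d B\<close> and \<open>B\<close>, indexed by the number
  \<open>d\<close>.\<close>

definition agreeing_below ::
    "'a set \<Rightarrow> ('a \<Rightarrow> 'a \<Rightarrow> bool) \<Rightarrow> (nat \<Rightarrow> 'a \<Rightarrow> 'b) \<Rightarrow> nat \<Rightarrow> 'a \<Rightarrow> 'a set" where
  "agreeing_below R le r d B = {A \<in> R. le A B \<and> r d A = r d B}"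

text \<open>\<open>dep B a\<close> plays the role of the depth of \<open>a\<close> in \<open>B\<close>, the length of the shortest approximation of
  \<open>B\<close> containing \<open>a\<close>; it is only meaningful if \<open>basic_set R le r a B\<close> is nonempty.\<close>

locale approximation_space =
  fixes R :: "'a set" and le :: "'a \<Rightarrow> 'a \<Rightarrow> bool" and r :: "nat \<Rightarrow> 'a \<Rightarrow> 'b"
    and dep :: "'a \<Rightarrow> 'b \<Rightarrow> nat"
  assumes le_refl: "le A A"
    and le_trans: "le A B \<Longrightarrow> le B C \<Longrightarrow> le A C"
    and approx_length: "A \<in> R \<Longrightarrow> B \<in> R \<Longrightarrow> r m A = r n B \<Longrightarrow> m = n"
    and approx_initial: "A \<in> R \<Longrightarrow> B \<in> R \<Longrightarrow> r n A = r n B \<Longrightarrow> m \<le> n \<Longrightarrow> r m A = r m B"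
    and finite_depth: "B \<in> R \<Longrightarrow> finite {a. basic_set R le r a B \<noteq> {} \<and> dep B a = d}"
    and depth_less: "A \<in> R \<Longrightarrow> B \<in> R \<Longrightarrow> le A B \<Longrightarrow> m < n \<Longrightarrow> dep B (r m A) < dep B (r n A)"
    and basic_nonempty: "B \<in> R \<Longrightarrow> basic_set R le r a B \<noteq> {} \<Longrightarrow>
          A \<in> agreeing_below R le r (dep B a) B \<Longrightarrow> basic_set R le r a A \<noteq> {}"
    and depth_cong: "B \<in> R \<Longrightarrow> A \<in> agreeing_below R le r d B \<Longrightarrow> basic_set R le r a A \<noteq> {} \<Longrightarrow>
          dep A a \<le> d \<or> dep B a \<le> d \<Longrightarrow> dep B a = dep A a"
    and amalgamation: "B \<in> R \<Longrightarrow> A \<in> R \<Longrightarrow> le A B \<Longrightarrow> basic_set R le r a A \<noteq> {} \<Longrightarrow>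
          \<exists>A' \<in> agreeing_below R le r (dep B a) B. basic_set R le r a A' \<subseteq> basic_set R le r a A"
    and pigeonhole: "B \<in> R \<Longrightarrow> A \<in> R \<Longrightarrow> le A B \<Longrightarrow>
          \<exists>C \<in> agreeing_below R le r (dep B (r n A)) B.
            (\<forall>Y \<in> basic_set R le r (r n A) C. r (Suc n) Y \<in> Q) \<or>
            (\<forall>Y \<in> basic_set R le r (r n A) C. r (Suc n) Y \<notin> Q)"
    and fusion_limit: "(\<And>n. S n \<in> R) \<Longrightarrow> (\<And>n. S (Suc n) \<in> agreeing_below R le r (d + n) (S n)) \<Longrightarrow>
          \<exists>C. \<forall>n. C \<in> agreeing_below R le r (d + n) (S n)"
begin

abbreviation basic where "basic \<equiv> basic_set R le r"
abbreviation agreeing where "agreeing \<equiv> agreeing_below R le r"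

section \<open>Basic sets, approximations and depth\<close>

lemma basic_iff: "Y \<in> basic a B \<longleftrightarrow> Y \<in> R \<and> le Y B \<and> (\<exists>n. r n Y = a)"
  by (auto simp: basic_set_def)

lemma agreeing_iff: "A \<in> agreeing d B \<longleftrightarrow> A \<in> R \<and> le A B \<and> r d A = r d B"
  by (auto simp: agreeing_below_def)

lemma basic_mono: "le A B \<Longrightarrow> basic a A \<subseteq> basic a B"
  by (auto simp: basic_iff intro: le_trans)

lemma basic_self:
  assumes "Y \<in> basic a B" shows "Y \<in> R" "le Y B" "Y \<in> basic a Y" "basic a Y \<noteq> {}"
proof -
  show "Y \<in> R" "le Y B" and *: "Y \<in> basic a Y" using assms le_refl by (auto simp: basic_iff)
  show "basic a Y \<noteq> {}" using * by blast
qed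

lemma agreeing_trans: "A \<in> agreeing d B \<Longrightarrow> B \<in> agreeing d C \<Longrightarrow> A \<in> agreeing d C"
  by (auto simp: agreeing_iff intro: le_trans)

lemma agreeing_refl: "B \<in> R \<Longrightarrow> B \<in> agreeing d B"
  by (simp add: agreeing_iff le_refl)

lemma basic_approx_subset:
  assumes "Y \<in> R" "m \<le> n" shows "basic (r n Y) Z \<subseteq> basic (r m Y) Z"
proof
  fix X assume X: "X \<in> basic (r n Y) Z"
  then obtain q where "r q X = r n Y" by (auto simp: basic_iff)
  then have "r n X = r n Y" using X assms approx_length[of X Y q n] by (auto simp: basic_iff)
  then show "X \<in> basic (r m Y) Z"
    using X assms approx_initial[of X Y n m] by (auto simp: basic_iff)
qed

lemma depth_less_basic:
  assumes "B \<in> R" "Y \<in> basic a B" "r m Y = a" "m < n"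
  shows "dep B a < dep B (r n Y)"
  using assms depth_less[of Y B m n] by (auto simp: basic_iff)

lemma agreeing_depth:
  assumes "B \<in> R" "basic a B \<noteq> {}" "A \<in> agreeing (dep B a) B"
  shows "basic a A \<noteq> {}" "dep A a = dep B a"
  using basic_nonempty[OF assms] depth_cong[OF assms(1,3), of a] by auto

section \<open>Fusion\<close>

lemma fusion_step:
  assumes hered: "\<And>b B B'. P b B \<Longrightarrow> B' \<in> R \<Longrightarrow> le B' B \<Longrightarrow> P b B'"
    and dense: "\<And>b B. B \<in> R \<Longrightarrow> basic b B \<noteq> {} \<Longrightarrow> \<exists>B' \<in> agreeing (dep B b) B. P b B'"
    and B: "B \<in> R"
  shows "\<exists>B' \<in> agreeing d B. \<forall>b. basic b B \<noteq> {} \<and> dep B b = d \<longrightarrow> P b B'"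
proof -
  \<comment> \<open>Only finitely many \<open>b\<close> have depth \<open>d\<close>, so they are
    handled one at a time. Agreement up to \<open>d\<close> keeps the remaining ones at depth
    \<open>d\<close> with nonempty basic sets, and heredity keeps what has been achieved.\<close>
  have "\<exists>B' \<in> agreeing d B. \<forall>b \<in> F. P b B'"
    if "finite F" "F \<subseteq> {b. basic b B \<noteq> {} \<and> dep B b = d}" for F
    using that
  proof (induction F rule: finite_induct)
    case empty
    then show ?case using agreeing_refl[OF B] by auto
  next
    case (insert b F)
    then obtain B' where B': "B' \<in> agreeing d B" "\<forall>b \<in> F. P b B'" by auto
    have b: "basic b B' \<noteq> {}" "dep B' b = d"
      using agreeing_depth[OF B, of b B'] B' insert by auto
    have "B' \<in> R" using B' by (simp add: agreeing_iff)
    then obtain B'' where B'': "B'' \<in> agreeing d B'" "P b B''"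
      using dense[OF _ b(1)] b(2) by auto
    then have "\<forall>b \<in> F. P b B''" using hered B'(2) by (auto simp: agreeing_iff)
    then show ?case using B'' agreeing_trans[OF B''(1) B'(1)] by auto
  qed
  from this[OF finite_depth[OF B]] show ?thesis by auto
qed

text \<open>Stage \<open>n\<close> handles the approximations of depth \<open>d + n\<close> and
  keeps agreement up to \<open>d + n\<close>, so the stages have a limit, in which these
  approximations still have depth \<open>d + n\<close>. Letting \<open>P\<close> depend on the stage
  serves countable unions.\<close>

lemma fusion:
  assumes hered: "\<And>n b B B'. P n b B \<Longrightarrow> B' \<in> R \<Longrightarrow> le B' B \<Longrightarrow> P n b B'"
    and dense: "\<And>n b B. B \<in> R \<Longrightarrow> basic b B \<noteq> {} \<Longrightarrow> \<exists>B' \<in> agreeing (dep B b) B. P n b B'"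
    and A: "A \<in> R"
  shows "\<exists>B \<in> agreeing d A. \<forall>b n. basic b B \<noteq> {} \<and> dep B b = d + n \<longrightarrow> P n b B"
proof -
  define Q where "Q n B B' \<longleftrightarrow> B' \<in> agreeing (d + n) B \<and>
    (\<forall>b. basic b B \<noteq> {} \<and> dep B b = d + n \<longrightarrow> P n b B')" for n B B'
  have step: "\<exists>B'. B' \<in> R \<and> Q n B B'" if "B \<in> R" for B n
  proof -
    have "\<exists>B' \<in> agreeing (d + n) B. \<forall>b. basic b B \<noteq> {} \<and> dep B b = d + n \<longrightarrow> P n b B'"
      by (rule fusion_step) ((rule hered; assumption), (rule dense; assumption), rule that)
    then show ?thesis unfolding Q_def using agreeing_iff by blast
  qed
  obtain B where B0: "B 0 = A" and BR: "\<And>n. B n \<in> R" and BQ: "\<And>n. Q n (B n) (B (Suc n))"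
  proof -
    have "\<exists>f. \<forall>n. (f n \<in> R \<and> (n = 0 \<longrightarrow> f n = A)) \<and> Q n (f n) (f (Suc n))"
      by (rule dependent_nat_choice) (use A step in auto)
    then show ?thesis using that by blast
  qed
  obtain C where C: "\<And>n. C \<in> agreeing (d + n) (B n)"
    using fusion_limit[where S = B and d = d] BR BQ unfolding Q_def by blast
  have "P n b C" if "basic b C \<noteq> {}" "dep C b = d + n" for b n
  proof -
    have "dep (B n) b = d + n" using depth_cong[OF BR C that(1)] that(2) by simp
    moreover have "basic b (B n) \<noteq> {}"
      using that(1) C[of n] basic_mono unfolding agreeing_iff by blast
    ultimately have "P n b (B (Suc n))" using BQ unfolding Q_def by blast
    then show ?thesis using hered C[of "Suc n"] by (auto simp: agreeing_iff)
  qed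
  moreover have "C \<in> agreeing d A" using C[of 0] B0 by simp
  ultimately show ?thesis by blast
qed

lemma fusion_uniform:
  assumes hered: "\<And>b B B'. P b B \<Longrightarrow> B' \<in> R \<Longrightarrow> le B' B \<Longrightarrow> P b B'"
    and dense: "\<And>b B. B \<in> R \<Longrightarrow> basic b B \<noteq> {} \<Longrightarrow> \<exists>B' \<in> agreeing (dep B b) B. P b B'"
    and A: "A \<in> R"
  shows "\<exists>B \<in> agreeing d A. \<forall>b. basic b B \<noteq> {} \<and> d \<le> dep B b \<longrightarrow> P b B"
proof -
  have "\<exists>B \<in> agreeing d A. \<forall>b n. basic b B \<noteq> {} \<and> dep B b = d + n \<longrightarrow> P b B"
    by (rule fusion) ((rule hered; assumption), (rule dense; assumption), rule A)
  then obtain B where B: "B \<in> agreeing d A"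
    and P: "\<And>b n. basic b B \<noteq> {} \<and> dep B b = d + n \<longrightarrow> P b B"
    by blast
  have "P b B" if "basic b B \<noteq> {}" "d \<le> dep B b" for b
    using P[of b "dep B b - d"] that by simp
  then show ?thesis using B by blast
qed

section \<open>Combinatorial forcing\<close>

text \<open>Quantifying over all \<open>A\<close> below \<open>B\<close>, and not only over those agreeing with \<open>B\<close> up to the depth of
  \<open>b\<close>, makes rejection trivially hereditary; amalgamation then gives density.\<close>

definition rejects :: "'a set \<Rightarrow> 'b \<Rightarrow> 'a \<Rightarrow> bool" where
  "rejects \<X> b B \<longleftrightarrow> (\<forall>A \<in> R. le A B \<and> basic b A \<noteq> {} \<longrightarrow> \<not> basic b A \<subseteq> \<X>)"

lemma rejects_mono: "rejects \<X> b B \<Longrightarrow> le B' B \<Longrightarrow> rejects \<X> b B'"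
  unfolding rejects_def using le_trans by blast

text \<open>If \<open>b\<close> is not rejected, the witness accepting it lies below
  \<open>B\<close> but may disagree with \<open>B\<close> within the depth of \<open>b\<close>;
  amalgamation replaces it by one that agrees.\<close>

lemma decides_dense:
  assumes "B \<in> R" "basic b B \<noteq> {}"
  shows "\<exists>B' \<in> agreeing (dep B b) B. basic b B' \<subseteq> \<X> \<or> rejects \<X> b B'"
proof (cases "rejects \<X> b B")
  case True
  then show ?thesis using agreeing_refl[OF assms(1)] by blast
next
  case False
  then obtain A where "A \<in> R" "le A B" "basic b A \<noteq> {}" "basic b A \<subseteq> \<X>"
    by (auto simp: rejects_def)
  then show ?thesis using amalgamation[OF assms(1), of A b] by blast
qed

text \<open>Fusion first decides every approximation from the depth of \<open>b\<close> on. The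
  pigeonhole principle then makes the one-step extensions of \<open>b\<close> all accepted, which
  puts the basic set of \<open>b\<close> into \<open>\<X>\<close>, or all not accepted, which after
  the decision means rejected.\<close>

lemma rejects_extensions_dense:
  assumes B: "B \<in> R" "basic b B \<noteq> {}"
  shows "\<exists>B' \<in> agreeing (dep B b) B. basic b B' \<subseteq> \<X> \<or>
    (\<forall>Y \<in> basic b B'. \<forall>m. r m Y = b \<longrightarrow> rejects \<X> (r (Suc m) Y) B')"
proof -
  have hered: "basic c D' \<subseteq> \<X> \<or> rejects \<X> c D'"
    if "basic c D \<subseteq> \<X> \<or> rejects \<X> c D" "D' \<in> R" "le D' D" for c D D'
    using that basic_mono[OF that(3), of c] rejects_mono by blast
  have "\<exists>B1 \<in> agreeing (dep B b) B. \<forall>c. basic c B1 \<noteq> {} \<and> dep B b \<le> dep B1 c \<longrightarrow>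
          basic c B1 \<subseteq> \<X> \<or> rejects \<X> c B1"
    by (rule fusion_uniform) ((rule hered; assumption), (rule decides_dense; assumption), rule B(1))
  then obtain B1 where B1: "B1 \<in> agreeing (dep B b) B"
    and dec: "\<And>c. basic c B1 \<noteq> {} \<Longrightarrow> dep B b \<le> dep B1 c \<Longrightarrow>
               basic c B1 \<subseteq> \<X> \<or> rejects \<X> c B1"
    by blast
  note dep = agreeing_depth[OF B B1]
  have B1R: "B1 \<in> R" using B1 by (simp add: agreeing_iff)
  obtain Y0 n where Y0: "Y0 \<in> R" "le Y0 B1" "r n Y0 = b"
    using dep(1) unfolding ex_in_conv[symmetric] basic_iff by blast
  \<comment> \<open>The colour is acceptance by \<open>B1\<close>, so it does not depend on the
    \<open>C\<close> to be found.\<close>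
  obtain C where C: "C \<in> agreeing (dep B b) B1"
    and O: "(\<forall>Y \<in> basic b C. basic (r (Suc n) Y) B1 \<subseteq> \<X>) \<or>
            (\<forall>Y \<in> basic b C. \<not> basic (r (Suc n) Y) B1 \<subseteq> \<X>)"
    using pigeonhole[OF B1R Y0(1,2), of n "{c. basic c B1 \<subseteq> \<X>}"] Y0(3) dep(2) by auto
  have CB1: "le C B1" using C by (simp add: agreeing_iff)
  have CB: "C \<in> agreeing (dep B b) B" using agreeing_trans[OF C B1] .
  from O show ?thesis
  proof
    assume *: "\<forall>Y \<in> basic b C. basic (r (Suc n) Y) B1 \<subseteq> \<X>"
    have "Y \<in> \<X>" if Y: "Y \<in> basic b C" for Y
    proof -
      have "Y \<in> basic (r (Suc n) Y) B1" using Y CB1 le_trans by (auto simp: basic_iff)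
      then show ?thesis using * Y by blast
    qed
    then show ?thesis using CB by blast
  next
    assume *: "\<forall>Y \<in> basic b C. \<not> basic (r (Suc n) Y) B1 \<subseteq> \<X>"
    have "rejects \<X> (r (Suc m) Y) C" if Y: "Y \<in> basic b C" "r m Y = b" for Y m
    proof -
      have m: "m = n" using Y Y0 approx_length[of Y Y0 m n] by (auto simp: basic_iff)
      have "Y \<in> basic b B1" using Y(1) basic_mono[OF CB1] by blast
      then have "dep B b \<le> dep B1 (r (Suc m) Y)" "basic (r (Suc m) Y) B1 \<noteq> {}"
        using depth_less_basic[OF B1R _ Y(2), of "Suc m"] dep(2) unfolding ex_in_conv[symmetric] basic_iff
        by (auto intro!: exI[of _ Y])
      then have "rejects \<X> (r (Suc m) Y) B1" using dec * Y(1) m by blast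
      then show ?thesis using rejects_mono CB1 by blast
    qed
    then show ?thesis using CB by blast
  qed
qed

section \<open>The Ellentuck topology\<close>

abbreviation T where "T \<equiv> ellentuck_topology R le r"

lemma openin_basic: "n \<in> approximations R r \<Longrightarrow> B \<in> R \<Longrightarrow> openin T (basic n B)"
  unfolding ellentuck_topology_def by (rule topology_generated_by_Basis) blast

lemma topspace_ellentuck: "topspace T = R"
proof -
  have "Y \<in> basic (r 0 Y) Y \<and> r 0 Y \<in> approximations R r" if "Y \<in> R" for Y
    using that le_refl by (auto simp: basic_iff approximations_def)
  then show ?thesis
    unfolding ellentuck_topology_def topology_generated_by_topspace basic_set_def by blast
qed

text \<open>A basic set \<open>basic a B\<close> containing \<open>Y\<close> includes
  \<open>basic a Y\<close>, since \<open>Y\<close> lies below \<open>B\<close>; so neighbourhoods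
  centred at \<open>Y\<close> itself suffice. For an intersection the longer of the two
  approximations works.\<close>

lemma openin_ellentuck_basic:
  assumes "openin T U" "Y \<in> U"
  shows "\<exists>n. basic (r n Y) Y \<subseteq> U"
proof -
  have "generate_topology_on {basic a B | a B. a \<in> approximations R r \<and> B \<in> R} U"
    using assms(1) unfolding ellentuck_topology_def openin_topology_generated_by_iff .
  then show ?thesis using assms(2)
  proof (induction arbitrary: Y rule: generate_topology_on.induct)
    case (Int U V)
    then obtain m n where "basic (r m Y) Y \<subseteq> U" "basic (r n Y) Y \<subseteq> V" by blast
    moreover have "openin T U"
      using Int.hyps(1) unfolding ellentuck_topology_def openin_topology_generated_by_iff .
    then have "Y \<in> R" using Int.prems openin_subset topspace_ellentuck by blast
    ultimately have "basic (r (max m n) Y) Y \<subseteq> U \<inter> V"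
      using basic_approx_subset[of Y m "max m n" Y] basic_approx_subset[of Y n "max m n" Y] by auto
    then show ?case ..
  next
    case (UN K)
    then show ?case by blast
  next
    case (Basis S)
    then obtain a B n where "S = basic a B" "le Y B" "r n Y = a" by (auto simp: basic_iff)
    then show ?case using basic_mono by blast
  qed auto
qed

section \<open>Open, nowhere dense, meager and Baire sets\<close>

lemma ramseyI:
  assumes "\<And>a A. A \<in> R \<Longrightarrow> basic a A \<noteq> {} \<Longrightarrow>
    \<exists>B \<in> R. le B A \<and> basic a B \<noteq> {} \<and> (basic a B \<subseteq> \<X> \<or> basic a B \<inter> \<X> = {})"
  shows "ramsey R le r \<X>"
  unfolding ramsey_def
proof (intro ballI impI)
  fix a A assume "A \<in> R" "basic a A \<noteq> {}"
  then obtain B where B: "le B A" "basic a B \<noteq> {}" "basic a B \<subseteq> \<X> \<or> basic a B \<inter> \<X> = {}"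
    using assms by blast
  \<comment> \<open>\<open>B\<close> need not have \<open>a\<close> as an approximation itself; any
    member of \<open>basic a B\<close> does.\<close>
  then obtain C where C: "C \<in> basic a B" by blast
  then have "C \<in> basic a A" "basic a C \<subseteq> basic a B"
    using basic_mono B(1) by (auto simp: basic_iff intro: le_trans)
  then show "\<exists>B \<in> basic a A. basic a B \<subseteq> \<X> \<or> basic a B \<inter> \<X> = {}" using B(3) by blast
qed

lemma ramsey_nullI:
  assumes "\<And>a A. A \<in> R \<Longrightarrow> basic a A \<noteq> {} \<Longrightarrow>
    \<exists>B \<in> R. le B A \<and> basic a B \<noteq> {} \<and> basic a B \<inter> \<X> = {}"
  shows "ramsey_null R le r \<X>"
  unfolding ramsey_null_def
proof (intro ballI impI)
  fix a A assume "A \<in> R" "basic a A \<noteq> {}"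
  then obtain B where B: "le B A" "basic a B \<noteq> {}" "basic a B \<inter> \<X> = {}"
    using assms by blast
  then obtain C where C: "C \<in> basic a B" by blast
  then have "C \<in> basic a A" "basic a C \<subseteq> basic a B"
    using basic_mono B(1) by (auto simp: basic_iff intro: le_trans)
  then show "\<exists>B \<in> basic a A. basic a B \<inter> \<X> = {}" using B(3) by blast
qed

lemma basic_nonempty_approximation: "basic a A \<noteq> {} \<Longrightarrow> a \<in> approximations R r"
  unfolding ex_in_conv[symmetric] basic_iff approximations_def by blast

text \<open>Fusion yields a \<open>B\<close> in which rejection passes from approximations at least
  as deep as \<open>a\<close> to their one-step extensions. If \<open>a\<close> is rejected, so are
  all later approximations of every \<open>Y\<close> in \<open>basic a B\<close>; were such a
  \<open>Y\<close> in the open set \<open>\<X>\<close>, \<open>Y\<close> would accept some of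
  them.\<close>

lemma open_imp_ramsey:
  assumes "openin T \<X>" shows "ramsey R le r \<X>"
proof (rule ramseyI)
  fix a A assume A: "A \<in> R" "basic a A \<noteq> {}"
  let ?P = "\<lambda>b B. basic b B \<subseteq> \<X> \<or>
    (\<forall>Y \<in> basic b B. \<forall>m. r m Y = b \<longrightarrow> rejects \<X> (r (Suc m) Y) B)"
  have hered: "?P b B'" if "?P b B" "B' \<in> R" "le B' B" for b B B'
    using that(1) basic_mono[OF that(3), of b] rejects_mono[OF _ that(3)] by (meson subset_eq)
  have "\<exists>B \<in> agreeing (dep A a) A. \<forall>b. basic b B \<noteq> {} \<and> dep A a \<le> dep B b \<longrightarrow> ?P b B"
    by (rule fusion_uniform)
      ((rule hered; assumption), (rule rejects_extensions_dense; assumption), rule A(1))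
  then obtain B where B: "B \<in> agreeing (dep A a) A"
    and P: "\<And>b. basic b B \<noteq> {} \<Longrightarrow> dep A a \<le> dep B b \<Longrightarrow> ?P b B"
    by auto
  note dep = agreeing_depth[OF A B]
  have BR: "B \<in> R" and BA: "le B A" using B by (auto simp: agreeing_iff)
  show "\<exists>B \<in> R. le B A \<and> basic a B \<noteq> {} \<and> (basic a B \<subseteq> \<X> \<or> basic a B \<inter> \<X> = {})"
  proof (cases "rejects \<X> a B")
    case False
    then show ?thesis using le_trans[OF _ BA] by (auto simp: rejects_def)
  next
    case True
    have "Y \<notin> \<X>" if Y: "Y \<in> basic a B" for Y
    proof
      assume "Y \<in> \<X>"
      from Y obtain n where n: "r n Y = a" and YR: "Y \<in> R" and YB: "le Y B"
        by (auto simp: basic_iff)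
      have rej: "rejects \<X> (r m Y) B" if "n \<le> m" for m
        using that
      proof (induction m rule: dec_induct)
        case base
        show ?case using True n by simp
      next
        case (step m)
        have Ym: "Y \<in> basic (r m Y) B" using YR YB by (auto simp: basic_iff)
        have "dep A a \<le> dep B (r m Y)"
          using depth_less_basic[OF BR Y n, of m] step(1) dep(2) n by (cases "n = m") auto
        then have "?P (r m Y) B" using P[of "r m Y"] Ym by blast
        \<comment> \<open>\<open>B\<close> is itself among the sets over which
          \<open>rejects\<close> quantifies, so only the second alternative of \<open>?P\<close>
          remains.\<close>
        moreover have "\<not> basic (r m Y) B \<subseteq> \<X>"
          using step.IH Ym BR le_refl[of B] unfolding rejects_def by blast
        ultimately show ?case using Ym by blast
      qed
      obtain m where "basic (r m Y) Y \<subseteq> \<X>" using openin_ellentuck_basic[OF assms \<open>Y \<in> \<X>\<close>] by blast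
      then have "basic (r (max m n) Y) Y \<subseteq> \<X>"
        using basic_approx_subset[OF YR, of m "max m n" Y] by auto
      moreover have "Y \<in> basic (r (max m n) Y) Y" using YR le_refl by (auto simp: basic_iff)
      ultimately show False using rej[of "max m n"] YR YB unfolding rejects_def by auto
    qed
    then show ?thesis using BR BA dep(1) by blast
  qed
qed

text \<open>The complement of the closure is open, hence Ramsey. A homogeneous basic set inside the
  closure would be a nonempty open subset of it, so the homogeneous set avoids the closure.\<close>

lemma nowhere_dense_imp_ramsey_null:
  assumes "nowhere_dense_in T S" shows "ramsey_null R le r S"
proof (rule ramsey_nullI)
  fix a A assume A: "A \<in> R" "basic a A \<noteq> {}"
  let ?U = "R - T closure_of S"
  have "openin T ?U" using topspace_ellentuck closedin_closure_of[of T S]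
    by (metis closedin_def)
  then obtain B where B: "B \<in> basic a A" "basic a B \<subseteq> ?U \<or> basic a B \<inter> ?U = {}"
    using open_imp_ramsey A basic_nonempty_approximation[OF A(2)] unfolding ramsey_def by blast
  have BR: "B \<in> R" "le B A" and Ba: "B \<in> basic a B" using basic_self[OF B(1)] by auto
  have SR: "S \<subseteq> T closure_of S"
    using assms closure_of_subset unfolding nowhere_dense_in_def by blast
  have "basic a B \<subseteq> ?U"
  proof (rule ccontr)
    assume "\<not> basic a B \<subseteq> ?U"
    then have "basic a B \<inter> ?U = {}" using B(2) by blast
    then have "basic a B \<subseteq> T closure_of S" by (auto simp: basic_iff)
    then have "basic a B \<subseteq> T interior_of (T closure_of S)"
      using openin_basic[OF basic_nonempty_approximation[OF A(2)] BR(1)]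
      by (simp add: interior_of_maximal)
    then show False using assms Ba unfolding nowhere_dense_in_def by blast
  qed
  then have "basic a B \<inter> S = {}" using SR by blast
  then show "\<exists>B \<in> R. le B A \<and> basic a B \<noteq> {} \<and> basic a B \<inter> S = {}" using BR Ba by blast
qed

text \<open>Amalgamation turns Ramsey nullity into the density hypothesis of
  \<open>fusion\<close>.\<close>

lemma ramsey_null_dense:
  assumes "ramsey_null R le r S" "B \<in> R" "basic b B \<noteq> {}"
  shows "\<exists>B' \<in> agreeing (dep B b) B. basic b B' \<inter> S = {}"
proof -
  obtain A where A: "A \<in> basic b B" "basic b A \<inter> S = {}"
    using assms basic_nonempty_approximation[OF assms(3)] unfolding ramsey_null_def by blast
  then have "A \<in> R" "le A B" "basic b A \<noteq> {}" using basic_self by auto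
  then show ?thesis using amalgamation[OF assms(2), of A b] A(2) by blast
qed

lemma ramsey_null_Un:
  assumes "ramsey_null R le r S" "ramsey_null R le r S'"
  shows "ramsey_null R le r (S \<union> S')"
proof (rule ramsey_nullI)
  fix a A assume A: "A \<in> R" "basic a A \<noteq> {}"
  obtain B where B: "B \<in> agreeing (dep A a) A" "basic a B \<inter> S = {}"
    using ramsey_null_dense[OF assms(1) A] by blast
  note dep = agreeing_depth[OF A B(1)]
  have BR: "B \<in> R" "le B A" using B(1) by (auto simp: agreeing_iff)
  obtain C where C: "C \<in> agreeing (dep B a) B" "basic a C \<inter> S' = {}"
    using ramsey_null_dense[OF assms(2) BR(1) dep(1)] by blast
  then have "C \<in> R" "le C B" by (auto simp: agreeing_iff)
  moreover have "le C A" using le_trans[OF \<open>le C B\<close> BR(2)] .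
  ultimately show "\<exists>B \<in> R. le B A \<and> basic a B \<noteq> {} \<and> basic a B \<inter> (S \<union> S') = {}"
    using agreeing_depth(1)[OF BR(1) dep(1) C(1)] B(2) C(2) basic_mono[of C B a]
    by blast
qed

text \<open>Fusion makes the basic set of every approximation of depth \<open>dep A a + n\<close>
  avoid \<open>N 0, ..., N n\<close>. The approximations of a member of \<open>basic a B\<close>
  have unbounded depth, so it avoids every \<open>N i\<close>.\<close>

lemma meager_imp_ramsey_null:
  assumes "meager_in T \<X>" shows "ramsey_null R le r \<X>"
proof (rule ramsey_nullI)
  obtain N where N: "\<And>n::nat. nowhere_dense_in T (N n)" and X: "\<X> = (\<Union>n. N n)"
    using assms unfolding meager_in_def by blast
  have null: "ramsey_null R le r (\<Union>i\<le>n. N i)" for n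
  proof (induction n)
    case 0
    then show ?case using nowhere_dense_imp_ramsey_null[OF N] by simp
  next
    case (Suc n)
    then show ?case
      using ramsey_null_Un[OF nowhere_dense_imp_ramsey_null[OF N[of "Suc n"]]] by (simp add: atMost_Suc)
  qed
  fix a A assume A: "A \<in> R" "basic a A \<noteq> {}"
  have hered: "basic b B' \<inter> (\<Union>i\<le>n. N i) = {}"
    if "basic b B \<inter> (\<Union>i\<le>n. N i) = {}" "B' \<in> R" "le B' B" for n b B B'
    using that basic_mono[OF that(3), of b] by blast
  have "\<exists>B \<in> agreeing (dep A a) A. \<forall>b n. basic b B \<noteq> {} \<and> dep B b = dep A a + n \<longrightarrow>
          basic b B \<inter> (\<Union>i\<le>n. N i) = {}"
    by (rule fusion)
      ((rule hered; assumption), (rule ramsey_null_dense[OF null]; assumption), rule A(1))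
  then obtain B where B: "B \<in> agreeing (dep A a) A"
    and P: "\<forall>b n. basic b B \<noteq> {} \<and> dep B b = dep A a + n \<longrightarrow> basic b B \<inter> (\<Union>i\<le>n. N i) = {}"
    ..
  note dep = agreeing_depth[OF A B]
  have BR: "B \<in> R" and BA: "le B A" using B by (auto simp: agreeing_iff)
  have "Y \<notin> N i" if Y: "Y \<in> basic a B" for Y i
  proof -
    from Y obtain n where n: "r n Y = a" and YR: "Y \<in> R" and YB: "le Y B"
      by (auto simp: basic_iff)
    have grow: "dep B a + i \<le> dep B (r (n + i) Y)" for i
    proof (induction i)
      case (Suc i)
      then show ?case using depth_less[OF YR BR YB, of "n + i" "n + Suc i"] by simp
    qed (simp add: n)
    let ?b = "r (n + i) Y"
    have "Y \<in> basic ?b B" using YR YB by (auto simp: basic_iff)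
    moreover have "dep B ?b = dep A a + (dep B ?b - dep A a)" "i \<le> dep B ?b - dep A a"
      using grow[of i] dep(2) by auto
    ultimately show ?thesis using P[rule_format, of ?b "dep B ?b - dep A a"] by blast
  qed
  then show "\<exists>B \<in> R. le B A \<and> basic a B \<noteq> {} \<and> basic a B \<inter> \<X> = {}"
    using BR BA dep(1) X by blast
qed

text \<open>First shrink to where \<open>\<X>\<close> and the open set \<open>U\<close> coincide,
  then further to where \<open>U\<close> is decided.\<close>

lemma baire_imp_ramsey:
  assumes "baire_property_in T \<X>" shows "ramsey R le r \<X>"
proof (rule ramseyI)
  fix a A assume A: "A \<in> R" "basic a A \<noteq> {}"
  note a = basic_nonempty_approximation[OF A(2)]
  obtain U where U: "openin T U" "meager_in T (sym_diff \<X> U)"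
    using assms unfolding baire_property_in_def by blast
  obtain B where B: "B \<in> basic a A" "basic a B \<inter> sym_diff \<X> U = {}"
    using meager_imp_ramsey_null[OF U(2)] A a unfolding ramsey_null_def by blast
  have BR: "B \<in> R" "le B A" "basic a B \<noteq> {}" using basic_self[OF B(1)] by auto
  obtain C where C: "C \<in> basic a B" "basic a C \<subseteq> U \<or> basic a C \<inter> U = {}"
    using open_imp_ramsey[OF U(1)] BR a unfolding ramsey_def by blast
  have CR: "C \<in> R" "le C B" "basic a C \<noteq> {}" using basic_self[OF C(1)] by auto
  have "basic a C \<subseteq> \<X> \<or> basic a C \<inter> \<X> = {}"
    using B(2) C(2) basic_mono[OF CR(2), of a] by blast
  then show "\<exists>B \<in> R. le B A \<and> basic a B \<noteq> {} \<and> (basic a B \<subseteq> \<X> \<or> basic a B \<inter> \<X> = {})"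
    using CR le_trans[OF CR(2) BR(2)] by blast
qed

theorem topological_ramsey_space: "topological_ramsey_space R le r"
  unfolding topological_ramsey_space_def
  by (intro conjI allI impI baire_imp_ramsey meager_imp_ramsey_null)

end

section \<open>Members of \<open>\<E>\<^sub>k\<close> as tree embeddings\<close>

lemma sorted_le_last: "sorted xs \<Longrightarrow> x \<in> set xs \<Longrightarrow> x \<le> last xs"
  by (induction xs) auto

text \<open>Preservation of prefixes is written as commutation with \<open>take\<close>, so that
  values at leaves determine those at their initial segments.\<close>

definition tree_emb :: "nat \<Rightarrow> (nat list \<Rightarrow> nat list) \<Rightarrow> bool" where
  "tree_emb k g \<longleftrightarrow>
     (\<forall>j \<in> nondec_le k. g j \<in> nondec_le k \<and> length (g j) = length j \<and> (\<forall>q. g (take q j) = take q (g j))) \<and>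
     (\<forall>j \<in> nondec_le k. \<forall>l \<in> nondec_le k. prec j l \<longrightarrow> prec (g j) (g l))"

definition emb_map :: "nat \<Rightarrow> (nat list \<Rightarrow> nat list) \<Rightarrow> (nat list \<rightharpoonup> nat set)" where
  "emb_map k g = (\<lambda>j. Some (W_set k (g j))) |` nondec_eq k"

section \<open>Initial segments, \<open>prec\<close> and the coding by \<open>W_set\<close>\<close>

lemma take_nondec_le: "j \<in> nondec_le k \<Longrightarrow> take q j \<in> nondec_le k"
  by (auto simp: nondec_le_def sorted_wrt_take)

lemma butlast_nondec_le: "j \<in> nondec_le k \<Longrightarrow> butlast j \<in> nondec_le k"
  by (simp add: butlast_conv_take take_nondec_le)

lemma Nil_nondec_le [simp]: "[] \<in> nondec_le k"
  by (simp add: nondec_le_def)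

lemma prec_strict_prefix:
  assumes "sorted l" "strict_prefix j l" shows "prec j l"
proof -
  obtain x u where l: "l = j @ x # u" using assms(2) by (auto elim: strict_prefixE')
  have "last j \<le> last l" if "j \<noteq> []"
  proof -
    have "last j \<in> set j" "last l \<in> set (x # u)" using that l by auto
    then show ?thesis using assms(1) unfolding l sorted_append by blast
  qed
  then show ?thesis unfolding prec_def using l lexord_append_rightI[of "x # u" j] by fastforce
qed

lemma prefix_eq_or_prec: "sorted l \<Longrightarrow> prefix j l \<Longrightarrow> j = l \<or> prec j l"
  using prec_strict_prefix by (auto simp: strict_prefix_def)

text \<open>The first difference occurs within \<open>j\<close>, so appending to \<open>j\<close>
  cannot alter the comparison.\<close>

lemma lexord_append_not_prefix:
  "(j, l) \<in> lexord r \<Longrightarrow> \<not> prefix j l \<Longrightarrow> (j @ u, l) \<in> lexord r"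
proof (induction j arbitrary: l)
  case (Cons x j)
  then show ?case by (cases l) auto
qed simp

lemma prec_take:
  assumes "j \<in> nondec_le k" "p < q" "q \<le> length j"
  shows "prec (take p j) (take q j)"
proof (rule prec_strict_prefix)
  show "sorted (take q j)" using assms(1) by (auto simp: nondec_le_def sorted_wrt_take)
  have "take p j = take p (take q j)" using assms by (simp add: min_def)
  then have "prefix (take p j) (take q j)" by (metis take_is_prefix)
  moreover have "length (take p j) \<noteq> length (take q j)" using assms by simp
  ultimately show "strict_prefix (take p j) (take q j)" unfolding strict_prefix_def by metis
qed

lemma sorted_list_of_W_set:
  assumes "j \<in> nondec_le k"
  shows "sorted_list_of_set (W_set k j) = map (\<lambda>q. prec_index (nondec_le k) (take q j)) [1..<Suc (length j)]"
    (is "_ = ?xs")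
proof -
  have "prec_index (nondec_le k) (take p j) < prec_index (nondec_le k) (take q j)"
    if "p < q" "q \<le> length j" for p q
    using prec_index_strict_mono[OF order_refl take_nondec_le prec_take] assms that by blast
  then have "sorted_wrt (<) ?xs"
    unfolding sorted_wrt_map by (rule sorted_wrt_mono_rel[OF _ sorted_wrt_upt]) auto
  then have "sorted_list_of_set (set ?xs) = ?xs"
    by (intro sorted_list_of_set.idem_if_sorted_distinct) (auto simp: strict_sorted_iff)
  moreover have "set ?xs = W_set k j" unfolding W_set_def by (auto simp: image_iff less_Suc_eq_le)
  ultimately show ?thesis by simp
qed

lemma finite_W_set: "finite (W_set k j)"
proof -
  have "W_set k j \<subseteq> (\<lambda>q. prec_index (nondec_le k) (take q j)) ` {..length j}"
    by (auto simp: W_set_def)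
  then show ?thesis by (rule finite_subset) simp
qed

lemma card_W_set: "j \<in> nondec_le k \<Longrightarrow> card (W_set k j) = length j"
  using sorted_list_of_W_set[of j k] sorted_list_of_set.length_sorted_key_list_of_set[of "W_set k j"]
  by (simp del: upt_Suc)

lemma Max_W_set:
  assumes "j \<in> nondec_le k" "j \<noteq> []"
  shows "Max (W_set k j) = prec_index (nondec_le k) j"
proof (rule Max_eqI[OF finite_W_set])
  fix y assume "y \<in> W_set k j"
  then obtain q where q: "q \<le> length j" "y = prec_index (nondec_le k) (take q j)"
    by (auto simp: W_set_def)
  show "y \<le> prec_index (nondec_le k) j"
  proof (cases "q = length j")
    case False
    then show ?thesis
      using q prec_take[OF assms(1), of q "length j"]
        prec_index_strict_mono[OF order_refl take_nondec_le[OF assms(1)]] by fastforce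
  qed (use q in auto)
next
  show "prec_index (nondec_le k) j \<in> W_set k j"
    using assms(2) by (auto simp: W_set_def Suc_le_eq intro!: exI[of _ "length j"])
qed

text \<open>The largest element of \<open>W_set k j\<close> is the index of \<open>j\<close> itself,
  and indices are injective; the empty sequence is recognised by its length.\<close>

lemma W_set_inj:
  assumes "j \<in> nondec_le k" "l \<in> nondec_le k" "W_set k j = W_set k l"
  shows "j = l"
proof -
  have len: "length j = length l" using assms card_W_set by metis
  show ?thesis
  proof (cases "j = []")
    case False
    then have "prec_index (nondec_le k) j = prec_index (nondec_le k) l"
      using assms Max_W_set len by (metis length_0_conv)
    then show ?thesis using inj_onD[OF prec_index_inj[OF order_refl]] assms by metis
  qed (use len in auto)
qed

lemma set_strict_prefix_W_set:
  assumes j: "j \<in> nondec_le k" and l: "l \<in> nondec_le k"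
  shows "set_strict_prefix (W_set k j) (W_set k l) \<longleftrightarrow> strict_prefix j l"
proof -
  let ?I = "prec_index (nondec_le k)"
  let ?L = "\<lambda>j. map (\<lambda>q. ?I (take q j)) [1..<Suc (length j)]"
  have "strict_prefix (?L j) (?L l) \<longleftrightarrow> strict_prefix j l"
  proof
    assume *: "strict_prefix (?L j) (?L l)"
    have len: "length j < length l" using prefix_length_less[OF *] by (simp del: upt_Suc)
    show "strict_prefix j l"
    proof (cases "j = []")
      case False
      let ?n = "length j - 1"
      have n: "?n < length (?L j)" using False by (simp del: upt_Suc)
      \<comment> \<open>The last entry listed for \<open>j\<close> is the index of \<open>j\<close>;
        the same position for \<open>l\<close> holds the index of its initial segment of that
        length.\<close>
      have "?L j ! ?n = ?L l ! ?n" using * n by (auto simp: strict_prefix_def prefix_def nth_append simp del: upt_Suc)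
      then have "?I j = ?I (take (length j) l)" using n len False by (simp del: upt_Suc)
      then have "j = take (length j) l"
        using inj_onD[OF prec_index_inj[OF order_refl], OF _ j take_nondec_le[OF l]] by blast
      then show ?thesis using len by (metis take_is_prefix strict_prefix_def less_irrefl)
    qed (use len in \<open>auto simp: strict_prefix_def\<close>)
  next
    assume *: "strict_prefix j l"
    then have len: "length j < length l" by (rule prefix_length_less)
    have jl: "take q l = take q j" if "q \<le> length j" for q
      using * that by (auto simp: strict_prefix_def prefix_def)
    have "take (length j) (?L l) = ?L j"
      by (rule nth_equalityI) (use len jl in \<open>auto simp del: upt_Suc\<close>)
    then have "prefix (?L j) (?L l)" by (metis take_is_prefix)
    moreover have "length (?L j) \<noteq> length (?L l)" using len by (simp del: upt_Suc)
    ultimately show "strict_prefix (?L j) (?L l)" unfolding strict_prefix_def by metis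
  qed
  then show ?thesis unfolding set_strict_prefix_def sorted_list_of_W_set[OF j] sorted_list_of_W_set[OF l] .
qed

section \<open>Enumeration of the nodes and leaves\<close>

locale nondec_tree =
  fixes k :: nat
  assumes k_pos: "1 \<le> k"
begin

abbreviation nodes where "nodes \<equiv> nondec_le k"
abbreviation leaves where "leaves \<equiv> nondec_eq k"
abbreviation leaf where "leaf \<equiv> prec_nth leaves"
abbreviation rank where "rank \<equiv> prec_index leaves"
abbreviation emb where "emb \<equiv> tree_emb k"
abbreviation emap where "emap \<equiv> emb_map k"

lemma leaf_node: "l \<in> leaves \<Longrightarrow> l \<in> nodes"
  using nondec_eq_subset by blast

lemma leaf_in [simp]: "leaf n \<in> leaves"
  using bij_betw_prec_nth(1)[OF nondec_eq_subset infinite_nondec_eq[OF k_pos]]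
  by (auto simp: bij_betw_def)

lemma leaf_in_nodes [simp]: "leaf n \<in> nodes"
  using leaf_node leaf_in by blast

lemma rank_leaf [simp]: "rank (leaf n) = n"
  by (rule bij_betw_prec_nth(2)[OF nondec_eq_subset infinite_nondec_eq[OF k_pos]])

lemma leaf_rank [simp]: "l \<in> leaves \<Longrightarrow> leaf (rank l) = l"
  by (rule prec_nth_index[OF nondec_eq_subset])

lemma prec_leaf [simp]: "prec (leaf m) (leaf n) \<longleftrightarrow> m < n"
  by (rule bij_betw_prec_nth(3)[OF nondec_eq_subset infinite_nondec_eq[OF k_pos]])

lemma leaf_eq [simp]: "leaf m = leaf n \<longleftrightarrow> m = n"
  by (metis rank_leaf)

lemma nodes_bij: "bij_betw (prec_nth nodes) UNIV nodes"
  and prec_node [simp]: "prec (prec_nth nodes m) (prec_nth nodes n) \<longleftrightarrow> m < n"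
  using bij_betw_prec_nth[OF order_refl infinite_nondec_le[OF k_pos]] by auto

lemma node_in [simp]: "prec_nth nodes m \<in> nodes"
  using nodes_bij by (auto simp: bij_betw_def)

lemma node_cases: assumes "j \<in> nodes" obtains m where "j = prec_nth nodes m"
  using nodes_bij assms by (auto simp: bij_betw_def)

lemma node_0: "prec_nth nodes 0 = []"
proof (rule ccontr)
  assume *: "prec_nth nodes 0 \<noteq> []"
  obtain m where "[] = prec_nth nodes m" using node_cases[of "[]"] by auto
  moreover have "prec [] (prec_nth nodes 0)" using * by (auto simp: prec_def)
  ultimately show False using prec_node[of m 0] by simp
qed

lemma sorted_node: "j \<in> nodes \<Longrightarrow> sorted j" and length_node: "j \<in> nodes \<Longrightarrow> length j \<le> k"
  by (auto simp: nondec_le_def)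

lemma length_leaf: "l \<in> leaves \<Longrightarrow> length l = k"
  by (simp add: nondec_eq_def)

lemma leaves_iff: "l \<in> leaves \<longleftrightarrow> l \<in> nodes \<and> length l = k"
  by (auto simp: nondec_eq_def nondec_le_def)

section \<open>Nodes on the first branches\<close>

lemma pad_leaf:
  assumes "j \<in> nodes"
  shows "j @ replicate (k - length j) (last j) \<in> leaves"
proof -
  have "x \<le> last j" if "x \<in> set j" for x
    using sorted_le_last[OF sorted_node[OF assms] that] .
  then show ?thesis using assms by (auto simp: nondec_eq_def nondec_le_def sorted_append)
qed

lemma node_extends: assumes "j \<in> nodes" obtains l where "l \<in> leaves" "prefix j l"
  using pad_leaf[OF assms] by (meson prefixI)

text \<open>Padding \<open>j\<close> with its last entry keeps \<open>last\<close> and, unless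
  \<open>j\<close> is a prefix of \<open>leaf n\<close>, also the lexicographic comparison. The
  padded leaf extends \<open>j\<close> and still precedes \<open>leaf n\<close>.\<close>

lemma node_below_leaf:
  assumes j: "j \<in> nodes" and n: "\<not> prec (leaf n) j"
  shows "\<exists>p \<le> n. prefix j (leaf p)"
proof (cases "prefix j (leaf n)")
  case False
  let ?w = "j @ replicate (k - length j) (last j)"
  have ne: "j \<noteq> []" "j \<noteq> leaf n" using False by auto
  then have pr: "prec j (leaf n)" using n prec_linear by blast
  have lex: "(?w, leaf n) \<in> lexord less_than" if "(j, leaf n) \<in> lexord less_than"
    using lexord_append_not_prefix[OF that False] .
  have "last ?w = last j" by (cases "k - length j = 0") auto
  then have "prec ?w (leaf n)" using pr lex ne(1) by (auto simp: prec_def)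
  moreover have "leaf (rank ?w) = ?w" using pad_leaf[OF j] by simp
  ultimately have "rank ?w < n" using prec_leaf[of "rank ?w" n] by simp
  moreover have "prefix j (leaf (rank ?w))" using \<open>leaf (rank ?w) = ?w\<close> by simp
  ultimately show ?thesis using less_imp_le by blast
qed auto

text \<open>By \<open>node_below_leaf\<close>, the nodes on the first \<open>d\<close> branches form an initial segment under \<open>prec\<close>.\<close>

definition old :: "nat \<Rightarrow> nat list \<Rightarrow> bool" where
  "old d j \<longleftrightarrow> (\<exists>p < d. prefix j (leaf p))"

lemma old_prefix: "old d l \<Longrightarrow> prefix j l \<Longrightarrow> old d j"
  unfolding old_def by (meson prefix_order.trans)

lemma prefix_leaf_prec: "prefix j (leaf p) \<Longrightarrow> j = leaf p \<or> prec j (leaf p)"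
  by (rule prefix_eq_or_prec[OF sorted_node[OF leaf_in_nodes]])

lemma old_prec:
  assumes "j \<in> nodes" "prec j l" "old d l"
  shows "old d j"
proof -
  obtain p where p: "p < d" "prefix l (leaf p)" using assms(3) by (auto simp: old_def)
  have "prec j (leaf p)" using prefix_leaf_prec[OF p(2)] assms(2) prec_trans by blast
  then have "\<not> prec (leaf p) j" using prec_trans prec_irrefl by blast
  then obtain p' where "p' \<le> p" "prefix j (leaf p')" using node_below_leaf[OF assms(1)] by blast
  then show ?thesis using p(1) by (auto simp: old_def intro: exI[of _ p'])
qed

section \<open>Tree embeddings and their correspondence with \<open>E_space\<close>\<close>

lemma embD:
  assumes "emb g" "j \<in> nodes"
  shows "g j \<in> nodes" "length (g j) = length j" "g (take q j) = take q (g j)"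
  using assms by (auto simp: tree_emb_def)

lemma emb_prec: "emb g \<Longrightarrow> j \<in> nodes \<Longrightarrow> l \<in> nodes \<Longrightarrow> prec j l \<Longrightarrow> prec (g j) (g l)"
  by (auto simp: tree_emb_def)

lemma emb_leaves: "emb g \<Longrightarrow> l \<in> leaves \<Longrightarrow> g l \<in> leaves"
  by (auto simp: leaves_iff embD)

lemma emb_Nil: "emb g \<Longrightarrow> g [] = []"
  using embD(2)[of g "[]"] by simp

lemma emb_inj: "emb g \<Longrightarrow> j \<in> nodes \<Longrightarrow> l \<in> nodes \<Longrightarrow> g j = g l \<longleftrightarrow> j = l"
  using emb_prec[of g j l] emb_prec[of g l j] prec_irrefl[of "g l"] prec_linear[of j l] by auto

lemma emb_prec_iff: "emb g \<Longrightarrow> j \<in> nodes \<Longrightarrow> l \<in> nodes \<Longrightarrow> prec (g j) (g l) \<longleftrightarrow> prec j l"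
  using emb_prec[of g j l] emb_prec[of g l j] prec_irrefl[of "g j"] prec_linear[of j l]
    prec_trans[of "g j" "g l" "g j"] by auto

lemma emb_butlast: "emb g \<Longrightarrow> j \<in> nodes \<Longrightarrow> g (butlast j) = butlast (g j)"
  by (simp add: butlast_conv_take embD)

lemma emb_comp:
  assumes "emb g" "emb h" shows "emb (g \<circ> h)"
  using assms unfolding tree_emb_def by simp

lemma emb_agree:
  assumes "emb g" "emb h" "\<forall>p < n. g (leaf p) = h (leaf p)" "old n j"
  shows "g j = h j"
proof -
  obtain p where "p < n" "prefix j (leaf p)" using assms(4) by (auto simp: old_def)
  moreover from this have "j = take (length j) (leaf p)" by (auto simp: prefix_def)
  ultimately show ?thesis using embD(3)[OF assms(1)] embD(3)[OF assms(2)] assms(3) by (metis leaf_in_nodes)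
qed

lemma embI_butlast:
  assumes 1: "\<And>j. j \<in> nodes \<Longrightarrow> g j \<in> nodes \<and> length (g j) = length j"
    and 2: "\<And>j. j \<in> nodes \<Longrightarrow> j \<noteq> [] \<Longrightarrow> g (butlast j) = butlast (g j)"
    and 3: "\<And>j l. j \<in> nodes \<Longrightarrow> l \<in> nodes \<Longrightarrow> prec j l \<Longrightarrow> prec (g j) (g l)"
  shows "emb g"
proof -
  have "g (take q j) = take q (g j)" if "j \<in> nodes" for q j
    using that
  proof (induction j rule: rev_induct)
    case Nil
    then show ?case using 1[of "[]"] by simp
  next
    case (snoc x j)
    have j: "j \<in> nodes" using butlast_nondec_le[OF snoc.prems] by simp
    have b: "g j = butlast (g (j @ [x]))" using 2[OF snoc.prems] by simp
    have len: "length (g (j @ [x])) = Suc (length j)" using 1[OF snoc.prems] by simp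
    show ?case
    proof (cases "q \<le> length j")
      case True
      then show ?thesis using snoc.IH[OF j] b len by (simp add: butlast_conv_take)
    qed (use len in simp)
  qed
  then show ?thesis using 1 3 by (auto simp: tree_emb_def)
qed

text \<open>Under the coding \<open>W_set\<close> the clauses of \<open>E_tree\<close> become those
  of \<open>tree_emb\<close>: cardinality is length, the maximum is the index of the node, and
  initial segments of sets are prefixes of nodes.\<close>

lemma E_space_eq: "E_space k = emap ` {g. emb g}"
proof (intro equalityI subsetI)
  fix X assume "X \<in> E_space k"
  then obtain f where X: "X = (\<lambda>j. Some (f j)) |` leaves" and f: "E_tree k f"
    by (auto simp: E_space_def)
  have "\<exists>l. l \<in> nodes \<and> f j = W_set k l" if "j \<in> nodes" for j
    using f that by (auto simp: E_tree_def W_hat_def Pi_iff)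
  then obtain g where g: "\<And>j. j \<in> nodes \<Longrightarrow> g j \<in> nodes \<and> f j = W_set k (g j)" by metis
  have len: "length (g j) = length j" if "j \<in> nodes" for j
    using that g[OF that] card_W_set f by (metis E_tree_def node_cases)
  have pre: "strict_prefix (g j) (g l) \<longleftrightarrow> strict_prefix j l" if "j \<in> nodes" "l \<in> nodes" for j l
  proof -
    have "set_strict_prefix (f j) (f l) \<longleftrightarrow> strict_prefix j l"
      using f that by (metis E_tree_def node_cases)
    then show ?thesis using g[OF that(1)] g[OF that(2)] set_strict_prefix_W_set by simp
  qed
  have ne: "prec_nth nodes (Suc m) \<noteq> []" for m
    using prec_node[of 0 "Suc m"] node_0 prec_irrefl by auto
  \<comment> \<open>The root has index 0 and value \<open>{}\<close>, whose \<open>Max\<close>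
    carries no information; maxima are compared from index 1 on, whence the shift by
    \<open>Suc\<close>.\<close>
  have step: "prec_index nodes (g (prec_nth nodes (Suc m))) < prec_index nodes (g (prec_nth nodes (Suc (Suc m))))"
    for m
  proof -
    have "Max (f (prec_nth nodes (Suc m))) < Max (f (prec_nth nodes (Suc (Suc m))))"
      using f by (auto simp: E_tree_def)
    moreover have "Max (f (prec_nth nodes (Suc m))) = prec_index nodes (g (prec_nth nodes (Suc m)))" for m
      using g[OF node_in] Max_W_set len[OF node_in] ne by (metis length_0_conv)
    ultimately show ?thesis by simp
  qed
  have "prec (g j) (g l)" if jl: "j \<in> nodes" "l \<in> nodes" "prec j l" for j l
  proof (cases "j = []")
    case True
    then have "l \<noteq> []" using jl prec_irrefl by auto
    then show ?thesis using True len jl by (metis length_0_conv prec_def)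
  next
    case False
    obtain m n where mn: "j = prec_nth nodes m" "l = prec_nth nodes n" using jl node_cases by metis
    then have "m < n" using jl by simp
    moreover have "m \<noteq> 0" using False mn node_0 by metis
    ultimately obtain m' n' where m': "m = Suc m'" "n = Suc n'" "m' < n'"
      by (metis Suc_less_eq less_imp_Suc_add not0_implies_Suc add_Suc_right)
    have "prec_index nodes (g j) < prec_index nodes (g l)"
      using lift_Suc_mono_less[of "\<lambda>m. prec_index nodes (g (prec_nth nodes (Suc m)))", OF step m'(3)] mn m'
      by simp
    then show ?thesis
      using prec_linear[of "g j" "g l"] prec_index_strict_mono[OF order_refl, of "g l" k "g j"] g jl
      by fastforce
  qed
  moreover have "g (butlast j) = butlast (g j)" if j: "j \<in> nodes" "j \<noteq> []" for j
  proof -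
    have "strict_prefix (butlast j) j" using j(2)
      by (metis append_butlast_last_id strict_prefixI')
    then have "strict_prefix (g (butlast j)) (g j)" using pre butlast_nondec_le[OF j(1)] j(1) by blast
    then have "g (butlast j) = take (length (g (butlast j))) (g j)" by (auto simp: strict_prefix_def prefix_def)
    then show ?thesis using len[OF j(1)] len[OF butlast_nondec_le[OF j(1)]] by (simp add: butlast_conv_take)
  qed
  ultimately have "emb g" using g len by (intro embI_butlast) auto
  moreover have "X = emap g"
    unfolding X emb_map_def using g leaf_node by (auto simp: restrict_map_def fun_eq_iff)
  ultimately show "X \<in> emap ` {g. emb g}" by blast
next
  fix X assume "X \<in> emap ` {g. emb g}"
  then obtain g where g: "emb g" and X: "X = emap g" by blast
  let ?f = "\<lambda>j. W_set k (g j)"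
  have "E_tree k ?f"
    unfolding E_tree_def
  proof (intro conjI allI impI)
    show "?f \<in> nodes \<rightarrow> W_hat k" using embD(1)[OF g] by (auto simp: W_hat_def)
    show "card (?f (prec_nth nodes m)) = length (prec_nth nodes m)" for m
      using embD[OF g node_in] card_W_set by simp
    fix m n :: nat
    show "set_strict_prefix (?f (prec_nth nodes m)) (?f (prec_nth nodes n)) \<longleftrightarrow>
          strict_prefix (prec_nth nodes m) (prec_nth nodes n)" (is "?L \<longleftrightarrow> strict_prefix ?j ?l")
    proof -
      have "?L \<longleftrightarrow> strict_prefix (g ?j) (g ?l)"
        using set_strict_prefix_W_set embD(1)[OF g node_in] by blast
      also have "\<dots> \<longleftrightarrow> strict_prefix ?j ?l"
      proof
        assume *: "strict_prefix (g ?j) (g ?l)"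
        then have "g ?j = take (length ?j) (g ?l)"
          using embD(2)[OF g, of ?j] by (auto simp: strict_prefix_def prefix_def)
        then have "g ?j = g (take (length ?j) ?l)" using embD(3)[OF g, of ?l] by simp
        then have "?j = take (length ?j) ?l" using emb_inj[OF g, of ?j] take_nondec_le by simp
        moreover have "?j \<noteq> ?l" using * by auto
        ultimately show "strict_prefix ?j ?l" unfolding strict_prefix_def by (metis take_is_prefix)
      next
        assume *: "strict_prefix ?j ?l"
        then have "?j = take (length ?j) ?l" by (auto simp: strict_prefix_def prefix_def)
        then have "prefix (g ?j) (g ?l)" using embD(3)[OF g, of ?l] by (metis node_in take_is_prefix)
        moreover have "g ?j \<noteq> g ?l" using * emb_inj[OF g, of ?j ?l] by auto
        ultimately show "strict_prefix (g ?j) (g ?l)" by (simp add: strict_prefix_def)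
      qed
      finally show ?thesis .
    qed
    assume "1 \<le> m"
    then have m: "0 < m" by simp
    have ne: "g (prec_nth nodes m) \<noteq> []" if "0 < m" for m
      using prec_node[of 0 m] node_0 embD(2)[OF g, of "prec_nth nodes m"] that prec_irrefl[of "[]"] by auto
    show "Max (?f (prec_nth nodes m)) < Max (?f (prec_nth nodes (Suc m)))"
      using Max_W_set[OF embD(1)[OF g node_in]] ne[OF m] ne[of "Suc m"]
        prec_index_strict_mono[OF order_refl embD(1)[OF g node_in] emb_prec[OF g node_in node_in, of m "Suc m"]]
      by simp
  qed
  then show "X \<in> E_space k" unfolding X E_space_def emb_map_def by (auto intro!: exI[of _ ?f])
qed

subsection \<open>Constructing embeddings\<close>

text \<open>Recursion along \<open>prec\<close>: nodes on the first \<open>d\<close> branches are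
  fixed, and a new node extends the image of its parent by an entry from \<open>C\<close> that
  exceeds the last entries of all earlier images. Infinity of \<open>C v\<close> provides one; its
  size keeps the sequence non-decreasing and puts it after the earlier images.\<close>

lemma emb_extension:
  assumes C: "\<forall>v \<in> nodes. length v < k \<longrightarrow> infinite {y. C v y}"
  shows "\<exists>e. emb e \<and> (\<forall>p < d. e (leaf p) = leaf p) \<and>
    (\<forall>l \<in> nodes. l \<noteq> [] \<and> \<not> old d l \<longrightarrow>
      (\<exists>y. e l = e (butlast l) @ [y] \<and> C (e (butlast l)) y \<and>
        (butlast l \<noteq> [] \<longrightarrow> last (e (butlast l)) < y)))"
proof -
  \<comment> \<open>\<open>r\<close> is an admissible value at \<open>l\<close>, given
    \<open>f\<close> at the nodes before \<open>l\<close>; no other values of \<open>f\<close> are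
    consulted, as the recursion requires.\<close>
  define P where "P f l r \<longleftrightarrow> (l \<in> nodes \<longrightarrow> r \<in> nodes \<and> length r = length l \<and>
     (if l = [] \<or> old d l then r = l else
       (\<exists>y. r = f (butlast l) @ [y] \<and> C (f (butlast l)) y \<and>
         (\<forall>j \<in> nodes. prec j l \<and> j \<noteq> [] \<longrightarrow> last (f j) < y))))" for f l r
  have below: "(j, l) \<in> Wellfounded.measure (prec_index nodes)" if "j \<in> nodes" "prec j l" for j l
    using prec_index_strict_mono[OF order_refl that] by simp
  have butlast_below: "butlast l \<in> nodes \<and> prec (butlast l) l" if "l \<in> nodes" "l \<noteq> []" for l
    using that butlast_nondec_le prec_strict_prefix[OF sorted_node]
    by (metis append_butlast_last_id strict_prefixI')
  have "\<exists>f. \<forall>l. P f l (f l)"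
  proof (rule dependent_wf_choice)
    show "wf (Wellfounded.measure (prec_index nodes))" by simp
  next
    fix f g :: "nat list \<Rightarrow> nat list" and l r
    assume fg: "\<And>z. (z, l) \<in> Wellfounded.measure (prec_index nodes) \<Longrightarrow> f z = g z"
    have 1: "f j = g j" if "j \<in> nodes" "prec j l" for j using fg below[OF that] by blast
    have 2: "f (butlast l) = g (butlast l)" if "l \<in> nodes" "l \<noteq> []" using 1 butlast_below[OF that] by blast
    show "P f l r \<longleftrightarrow> P g l r" unfolding P_def using 1 2 by (auto simp: Ball_def)
  next
    fix l and f :: "nat list \<Rightarrow> nat list"
    assume IH: "\<And>j. (j, l) \<in> Wellfounded.measure (prec_index nodes) \<Longrightarrow> P f j (f j)"
    show "\<exists>r. P f l r"
    proof (cases "l \<in> nodes \<and> l \<noteq> [] \<and> \<not> old d l")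
      case False
      then show ?thesis unfolding P_def by (intro exI[of _ l]) auto
    next
      case True
      let ?b = "butlast l"
      have b: "?b \<in> nodes" "prec ?b l" using butlast_below True by auto
      have fb: "f ?b \<in> nodes" "length (f ?b) = length ?b"
        using IH[OF below[OF b]] b(1) by (auto simp: P_def)
      have len: "length (f ?b) < k" using True length_node[of l] fb(2) by (cases l) auto
      let ?F = "(\<lambda>j. last (f j)) ` {j \<in> nodes. prec j l}"
      have fin: "finite ?F" using finite_prec_below[OF order_refl] by blast
      obtain y where y: "C (f ?b) y" "Max (insert 0 ?F) < y"
        using C fb(1) len unfolding infinite_nat_iff_unbounded by blast
      have above: "last (f j) < y" if "j \<in> nodes" "prec j l" for j
        using y(2) fin that by auto
      have "x \<le> y" if "x \<in> set (f ?b)" for x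
      proof -
        have "x \<le> last (f ?b)" using sorted_le_last[OF sorted_node[OF fb(1)] that] .
        then show ?thesis using above[OF b] by simp
      qed
      then have "f ?b @ [y] \<in> nodes" using fb(1) len by (auto simp: nondec_le_def sorted_append)
      moreover have "length (f ?b @ [y]) = length l" using fb(2) True by (cases l) auto
      ultimately show ?thesis using True y(1) above unfolding P_def by auto
    qed
  qed
  then obtain e where e: "\<And>l. P e l (e l)" by blast
  have e1: "e l \<in> nodes \<and> length (e l) = length l" if "l \<in> nodes" for l
    using e[of l] that by (auto simp: P_def)
  have e_old: "e l = l" if "l \<in> nodes" "l = [] \<or> old d l" for l
    using e[of l] that by (auto simp: P_def)
  have e_new: "\<exists>y. e l = e (butlast l) @ [y] \<and> C (e (butlast l)) y \<and>
      (\<forall>j \<in> nodes. prec j l \<and> j \<noteq> [] \<longrightarrow> last (e j) < y)"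
    if "l \<in> nodes" "l \<noteq> []" "\<not> old d l" for l
    using e[of l] that by (auto simp: P_def)
  have "emb e"
  proof (rule embI_butlast)
    show "e l \<in> nodes \<and> length (e l) = length l" if "l \<in> nodes" for l using e1[OF that] .
  next
    fix l assume l: "l \<in> nodes" "l \<noteq> []"
    show "e (butlast l) = butlast (e l)"
    proof (cases "old d l")
      case True
      have "old d (butlast l)" using old_prefix[OF True] by (simp add: prefixeq_butlast)
      then show ?thesis using e_old True butlast_nondec_le[OF l(1)] l by simp
    next
      case False
      then show ?thesis using e_new[OF l] by auto
    qed
  next
    fix j l assume jl: "j \<in> nodes" "l \<in> nodes" "prec j l"
    have "l \<noteq> []" using jl(3) by (auto simp: prec_def)
    then have el: "e l \<noteq> []" using e1[OF jl(2)] by auto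
    \<comment> \<open>If \<open>l\<close> is on the first \<open>d\<close> branches then so is
      \<open>j\<close>, and both are fixed; otherwise the new last entry decides.\<close>
    consider "j = []" | "j \<noteq> []" "old d l" | "j \<noteq> []" "\<not> old d l" by blast
    then show "prec (e j) (e l)"
    proof cases
      case 1
      then show ?thesis using el e1[of "[]"] by (simp add: prec_def)
    next
      case 2
      then show ?thesis using old_prec[OF jl(1,3)] e_old jl by simp
    next
      case 3
      then obtain y where "e l = e (butlast l) @ [y]" "last (e j) < y"
        using e_new[OF jl(2) \<open>l \<noteq> []\<close>] jl by blast
      moreover have "e j \<noteq> []" using 3 e1[OF jl(1)] by auto
      ultimately show ?thesis by (simp add: prec_def)
    qed
  qed
  moreover have "e (leaf p) = leaf p" if "p < d" for p
    using e_old[of "leaf p"] that by (auto simp: old_def)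
  moreover have "\<exists>y. e l = e (butlast l) @ [y] \<and> C (e (butlast l)) y \<and>
      (butlast l \<noteq> [] \<longrightarrow> last (e (butlast l)) < y)"
    if "l \<in> nodes" "l \<noteq> [] \<and> \<not> old d l" for l
    using e_new[of l] that butlast_below[of l] by blast
  ultimately show ?thesis by blast
qed

section \<open>Amalgamation and pigeonhole below the identity\<close>

text \<open>The depth, in the identity, of the \<open>n\<close>-th approximation of \<open>f\<close>.\<close>

definition rank_after :: "(nat list \<Rightarrow> nat list) \<Rightarrow> nat \<Rightarrow> nat" where
  "rank_after f n = (case n of 0 \<Rightarrow> 0 | Suc m \<Rightarrow> Suc (rank (f (leaf m))))"

lemma rank_emb_less:
  assumes "emb f" "p < q" shows "rank (f (leaf p)) < rank (f (leaf q))"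
proof (rule prec_index_strict_mono[OF nondec_eq_subset])
  show "f (leaf p) \<in> leaves" using emb_leaves[OF assms(1) leaf_in] .
  show "prec (f (leaf p)) (f (leaf q))" using emb_prec[OF assms(1), of "leaf p" "leaf q"] assms(2) by simp
qed

lemma rank_less_rank_after: "emb f \<Longrightarrow> p < n \<Longrightarrow> rank (f (leaf p)) < rank_after f n"
  using rank_emb_less[of f p "n - 1"]
  by (cases n; cases "p = n - 1") (auto simp: rank_after_def less_Suc_eq)

lemma rank_after_less: "emb f \<Longrightarrow> m < n \<Longrightarrow> rank_after f m < rank_after f n"
  using rank_less_rank_after[of f "m - 1" m] rank_emb_less[of f "m - 1" "n - 1"]
  by (cases m; cases n) (auto simp: rank_after_def)

lemma fix_leaf_below:
  assumes "emb f" "\<forall>p < rank_after f n. e (leaf p) = leaf p" "p < n"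
  shows "e (f (leaf p)) = f (leaf p)"
  using assms(2)[rule_format, OF rank_less_rank_after[OF assms(1,3)]] emb_leaves[OF assms(1) leaf_in] by simp

text \<open>For the last old leaf \<open>leaf m\<close>, \<open>e\<close> fixes
  \<open>f (leaf m)\<close> and is injective, so \<open>u\<close> sends \<open>leaf m\<close> there.
  A new \<open>l\<close> comes after \<open>leaf m\<close>, hence \<open>u l\<close> comes after
  \<open>f (leaf m)\<close> and lies on none of the branches that \<open>e\<close> must fix.\<close>

lemma new_node_image:
  assumes f: "emb f" and u: "emb u" and e: "emb e"
    and e_fix: "\<forall>p < rank_after f n. e (leaf p) = leaf p"
    and eu: "\<forall>p < n. e (u (leaf p)) = f (leaf p)"
    and l: "l \<in> nodes" "\<not> old n l"
  shows "\<not> old (rank_after f n) (u l)"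
proof (cases n)
  case 0
  then show ?thesis by (simp add: old_def rank_after_def)
next
  case (Suc m)
  have "e (u (leaf m)) = e (f (leaf m))" using eu fix_leaf_below[OF f e_fix, of m] Suc by simp
  then have ufm: "u (leaf m) = f (leaf m)"
    using emb_inj[OF e] embD(1)[OF u leaf_in_nodes] embD(1)[OF f leaf_in_nodes] by blast
  have "prec (leaf m) l" using node_below_leaf[OF l(1), of m] l(2) Suc by (auto simp: old_def less_Suc_eq_le)
  then have pr: "prec (f (leaf m)) (u l)" using emb_prec[OF u leaf_in_nodes l(1)] ufm by metis
  show ?thesis
  proof
    assume "old (rank_after f n) (u l)"
    then obtain p where p: "p \<le> rank (f (leaf m))" "prefix (u l) (leaf p)"
      using Suc by (auto simp: old_def rank_after_def less_Suc_eq_le)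
    have "u l = leaf p \<or> prec (u l) (leaf p)" using prefix_leaf_prec[OF p(2)] .
    moreover have "leaf p = f (leaf m) \<or> prec (leaf p) (f (leaf m))"
      using p(1) prec_leaf[of p "rank (f (leaf m))"] emb_leaves[OF f leaf_in[of m]]
      by (cases "p = rank (f (leaf m))") auto
    ultimately show False using pr prec_trans prec_irrefl by metis
  qed
qed

text \<open>At a new node whose parent has its image in the range of \<open>f\<close>,
  \<open>e\<close> uses only entries that stay in this range. Then \<open>e \<circ> u\<close> begins
  like \<open>f\<close> and, by induction along branches, never leaves the range of
  \<open>f\<close>.\<close>

lemma emb_amalgamation:
  assumes f: "emb f"
  shows "\<exists>e. emb e \<and> (\<forall>p < rank_after f n. e (leaf p) = leaf p) \<and>
    (\<forall>u. emb u \<and> (\<forall>p < n. e (u (leaf p)) = f (leaf p)) \<longrightarrow> (\<forall>l \<in> nodes. e (u l) \<in> f ` nodes))"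
proof -
  let ?C = "\<lambda>v y. v \<in> f ` nodes \<longrightarrow> v @ [y] \<in> f ` nodes"
  have inf: "infinite {y. ?C v y}" if v: "v \<in> nodes" "length v < k" for v
  proof (cases "v \<in> f ` nodes")
    case True
    then obtain j where j: "j \<in> nodes" "v = f j" by blast
    have len: "length j < k" using v(2) embD(2)[OF f j(1)] j(2) by simp
    have jx: "j @ [x] \<in> nodes" if "last j \<le> x" for x
    proof -
      have "z \<le> last j" if "z \<in> set j" for z
        using sorted_le_last[OF sorted_node[OF j(1)] that] .
      then show ?thesis using j(1) len that by (fastforce simp: nondec_le_def sorted_append)
    qed
    have fjx: "f (j @ [x]) = v @ [last (f (j @ [x]))]" if "last j \<le> x" for x
    proof -
      have "f (j @ [x]) \<noteq> []" using embD(2)[OF f jx[OF that]] by auto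
      moreover have "butlast (f (j @ [x])) = v" using emb_butlast[OF f jx[OF that]] j(2) by simp
      ultimately show ?thesis by (metis append_butlast_last_id)
    qed
    \<comment> \<open>Images of distinct children of \<open>j\<close> extend the same
      \<open>v\<close>, so they differ in the last entry; this gives infinitely many
      entries.\<close>
    have "inj_on (\<lambda>x. last (f (j @ [x]))) {last j..}"
    proof (rule inj_onI)
      fix x y assume xy: "x \<in> {last j..}" "y \<in> {last j..}" "last (f (j @ [x])) = last (f (j @ [y]))"
      then have "f (j @ [x]) = f (j @ [y])" using fjx[of x] fjx[of y] by simp
      then show "x = y" using emb_inj[OF f jx jx, of x y] xy by simp
    qed
    then have "infinite ((\<lambda>x. last (f (j @ [x]))) ` {last j..})"
      using finite_imageD infinite_Ici by blast
    moreover have "(\<lambda>x. last (f (j @ [x]))) ` {last j..} \<subseteq> {y. ?C v y}"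
    proof
      fix y assume "y \<in> (\<lambda>x. last (f (j @ [x]))) ` {last j..}"
      then obtain x where "last j \<le> x" "y = last (f (j @ [x]))" by auto
      then have "v @ [y] = f (j @ [x])" "j @ [x] \<in> nodes" using fjx jx by auto
      then show "y \<in> {y. ?C v y}" by simp
    qed
    ultimately show ?thesis using finite_subset by blast
  qed simp
  have "\<forall>v \<in> nodes. length v < k \<longrightarrow> infinite {y. ?C v y}" using inf by blast
  from emb_extension[of ?C "rank_after f n", OF this] obtain e where e: "emb e"
    and e_fix: "\<forall>p < rank_after f n. e (leaf p) = leaf p"
    and e_new: "\<forall>l \<in> nodes. l \<noteq> [] \<and> \<not> old (rank_after f n) l \<longrightarrow>
        (\<exists>y. e l = e (butlast l) @ [y] \<and> ?C (e (butlast l)) y \<and>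
          (butlast l \<noteq> [] \<longrightarrow> last (e (butlast l)) < y))"
    by (elim exE conjE)
  have "e (u l) \<in> f ` nodes"
    if u: "emb u" and eu: "\<forall>p < n. e (u (leaf p)) = f (leaf p)" and l: "l \<in> nodes" for u l
    using l
  proof (induction l rule: rev_induct)
    case Nil
    have "e (u []) = f []" using emb_Nil[OF u] emb_Nil[OF e] emb_Nil[OF f] by simp
    then show ?case by (metis Nil imageI)
  next
    case (snoc x j)
    have j: "j \<in> nodes" using butlast_nondec_le[OF snoc.prems] by simp
    show ?case
    proof (cases "old n (j @ [x])")
      case True
      then have "(e \<circ> u) (j @ [x]) = f (j @ [x])"
        using emb_agree[OF emb_comp[OF e u] f, of n] eu by simp
      then show ?thesis using snoc.prems by simp
    next
      case False
      then have new: "\<not> old (rank_after f n) (u (j @ [x]))"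
        using new_node_image[OF f u e e_fix eu snoc.prems] by simp
      have "butlast (u (j @ [x])) = u j" using emb_butlast[OF u snoc.prems] by simp
      moreover have "u (j @ [x]) \<noteq> []" using embD(2)[OF u snoc.prems] by auto
      ultimately obtain y where "e (u (j @ [x])) = e (u j) @ [y]" "?C (e (u j)) y"
        using bspec[OF e_new embD(1)[OF u snoc.prems]] new by auto
      then show ?thesis using snoc.IH[OF j] by simp
    qed
  qed
  then show ?thesis using e e_fix by blast
qed

text \<open>\<open>e (u (leaf n))\<close> is the image under \<open>f\<close> of the longest initial
  segment of \<open>leaf n\<close> on earlier branches, followed by new entries. If \<open>e\<close>
  takes these from \<open>H\<close>, they list a subset of \<open>H\<close> of fixed size
  increasingly, and Ramsey's theorem for such subsets makes the colour constant.\<close>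

lemma emb_pigeonhole:
  fixes Q :: "nat list \<Rightarrow> bool"
  assumes f: "emb f"
  shows "\<exists>e. emb e \<and> (\<forall>p < rank_after f n. e (leaf p) = leaf p) \<and>
    (\<exists>b. \<forall>u. emb u \<and> (\<forall>p < n. e (u (leaf p)) = f (leaf p)) \<longrightarrow> Q (e (u (leaf n))) = b)"
proof -
  let ?i = "leaf n"
  have leni: "length ?i = k" using length_leaf[OF leaf_in] .
  \<comment> \<open>The length of the longest initial segment of \<open>leaf n\<close> on the first
    \<open>n\<close> branches. The alternative \<open>q = 0\<close> serves \<open>n = 0\<close>,
    where not even \<open>[]\<close> is \<open>old\<close>.\<close>
  define q where "q = (GREATEST q. q \<le> k \<and> (q = 0 \<or> old n (take q ?i)))"
  have q: "q \<le> k \<and> (q = 0 \<or> old n (take q ?i))"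
    unfolding q_def by (rule GreatestI_nat[where b = k and k = 0]) auto
  have q_max: "\<not> old n (take q' ?i)" if "q < q'" "q' \<le> k" for q'
    using that Greatest_le_nat[of "\<lambda>q. q \<le> k \<and> (q = 0 \<or> old n (take q ?i))" q' k]
    unfolding q_def by fastforce
  let ?v = "f (take q ?i)"
  obtain H b where H: "infinite H"
    and hom: "\<And>Y. Y \<subseteq> H \<Longrightarrow> finite Y \<Longrightarrow> card Y = k - q \<Longrightarrow> Q (?v @ sorted_list_of_set Y) = b"
  proof -
    let ?c = "\<lambda>Y. if Q (?v @ sorted_list_of_set Y) then 1 else 0 :: nat"
    have "\<exists>H t. H \<subseteq> UNIV \<and> infinite H \<and> t < 2 \<and>
        (\<forall>Y. Y \<subseteq> H \<and> finite Y \<and> card Y = k - q \<longrightarrow> ?c Y = t)"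
      by (rule Ramsey) auto
    then obtain H t where Ht: "infinite H" "\<forall>Y. Y \<subseteq> H \<and> finite Y \<and> card Y = k - q \<longrightarrow> ?c Y = t"
      by blast
    have "Q (?v @ sorted_list_of_set Y) = (t = 1)" if "Y \<subseteq> H" "finite Y" "card Y = k - q" for Y
      using Ht(2)[rule_format, of Y] that by (auto split: if_splits)
    then show ?thesis using that Ht(1) by blast
  qed
  have "\<forall>v \<in> nodes. length v < k \<longrightarrow> infinite {y. y \<in> H}" using H by simp
  from emb_extension[of "\<lambda>v y. y \<in> H" "rank_after f n", OF this] obtain e where e: "emb e"
    and e_fix: "\<forall>p < rank_after f n. e (leaf p) = leaf p"
    and e_new: "\<forall>l \<in> nodes. l \<noteq> [] \<and> \<not> old (rank_after f n) l \<longrightarrow>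
        (\<exists>y. e l = e (butlast l) @ [y] \<and> y \<in> H \<and> (butlast l \<noteq> [] \<longrightarrow> last (e (butlast l)) < y))"
    by (elim exE conjE)
  have "Q (e (u ?i)) = b" if u: "emb u" and eu: "\<forall>p < n. e (u (leaf p)) = f (leaf p)" for u
  proof -
    have "\<exists>ys. e (u (take (q + t) ?i)) = ?v @ ys \<and> sorted_wrt (<) ys \<and> set ys \<subseteq> H \<and> length ys = t"
      if "q + t \<le> k" for t
      using that
    proof (induction t)
      case 0
      have "e (u (take q ?i)) = ?v"
      proof (cases "q = 0")
        case True
        then show ?thesis using emb_Nil[OF u] emb_Nil[OF e] emb_Nil[OF f] by simp
      next
        case False
        then show ?thesis
          using emb_agree[OF emb_comp[OF e u] f, of n "take q ?i"] eu q by simp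
      qed
      then show ?case by simp
    next
      case (Suc t)
      then obtain ys where ys: "e (u (take (q + t) ?i)) = ?v @ ys" "sorted_wrt (<) ys" "set ys \<subseteq> H"
          "length ys = t" by auto
      let ?l = "take (Suc (q + t)) ?i"
      have l: "?l \<in> nodes" using take_nondec_le[OF leaf_in_nodes] .
      have new: "\<not> old (rank_after f n) (u ?l)"
        using new_node_image[OF f u e e_fix eu l q_max] Suc.prems by simp
      have ne: "u ?l \<noteq> []" using embD(2)[OF u l] leni Suc.prems by auto
      have "butlast ?l = take (q + t) ?i" using leni Suc.prems by (simp add: butlast_take)
      then have bl: "butlast (u ?l) = u (take (q + t) ?i)" using emb_butlast[OF u l] by metis
      obtain y where y: "e (u ?l) = ?v @ ys @ [y]" "y \<in> H"
          "u (take (q + t) ?i) \<noteq> [] \<longrightarrow> last (?v @ ys) < y"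
        using bspec[OF e_new embD(1)[OF u l]] ne new unfolding bl ys(1) by auto
      \<comment> \<open>As \<open>ys\<close> is nonempty the parent is not the root, so the growth
        clause of \<open>emb_extension\<close> applies to the new entry.\<close>
      have "x < y" if x: "x \<in> set ys" for x
      proof -
        have ne: "ys \<noteq> []" using x by auto
        have "u (take (q + t) ?i) \<noteq> []"
          using ys(1) ne emb_Nil[OF e] by auto
        then have "last ys < y" using y(3) ne by simp
        moreover have "x \<le> last ys"
          using ys(2) sorted_le_last[OF _ x] by (simp add: strict_sorted_iff)
        ultimately show ?thesis by simp
      qed
      then have "sorted_wrt (<) (ys @ [y])" using ys(2) by (simp add: sorted_wrt_append)
      then show ?case using y ys by (intro exI[of _ "ys @ [y]"]) auto
    qed
    from this[of "k - q"] obtain ys where ys: "e (u ?i) = ?v @ ys" "sorted_wrt (<) ys" "set ys \<subseteq> H"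
        "length ys = k - q"
      using q leni by auto
    have "sorted_list_of_set (set ys) = ys" "card (set ys) = k - q"
      using ys(2,4) sorted_list_of_set.idem_if_sorted_distinct[of ys] distinct_card[of ys]
      by (auto simp: strict_sorted_iff)
    then show ?thesis using hom[of "set ys"] ys(1,3) by simp
  qed
  then show ?thesis using e e_fix by (intro exI[of _ e] exI[of _ b] conjI allI impI) auto
qed

subsection \<open>The axioms for \<open>\<E>\<^sub>k\<close>\<close>

lemma ran_emap: "ran (emap g) = (\<lambda>l. W_set k (g l)) ` leaves"
  by (auto simp: emb_map_def ran_def restrict_map_def)

lemma approx_emap: "E_approx k n (emap g) = (\<lambda>j. Some (W_set k (g j))) |` (leaf ` {..<n})"
proof -
  have "{leaf p | p. p < n} = leaf ` {..<n}" by auto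
  moreover have "leaves \<inter> leaf ` {..<n} = leaf ` {..<n}" by auto
  ultimately show ?thesis by (simp add: E_approx_def emb_map_def)
qed

lemma ran_approx_emap: "ran (E_approx k n (emap g)) = (\<lambda>p. W_set k (g (leaf p))) ` {..<n}"
  unfolding approx_emap by (auto simp: ran_def restrict_map_def)

lemma dom_approx_emap: "dom (E_approx k n (emap g)) = leaf ` {..<n}"
  unfolding approx_emap by (auto simp: dom_def restrict_map_def)

lemma W_set_eq: "j \<in> nodes \<Longrightarrow> l \<in> nodes \<Longrightarrow> W_set k j = W_set k l \<longleftrightarrow> j = l"
  using W_set_inj by blast

lemma approx_eq_iff:
  assumes "emb g" "emb h"
  shows "E_approx k m (emap g) = E_approx k n (emap h) \<longleftrightarrow> m = n \<and> (\<forall>p < n. g (leaf p) = h (leaf p))"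
proof
  assume *: "E_approx k m (emap g) = E_approx k n (emap h)"
  have "inj_on leaf A" for A by (auto simp: inj_on_def)
  then have "card (dom (E_approx k n (emap g))) = n" for n g
    by (simp add: dom_approx_emap card_image)
  then have mn: "m = n" using * by metis
  have "g (leaf p) = h (leaf p)" if "p < n" for p
    using fun_cong[OF *, of "leaf p"] that mn W_set_eq embD(1)[OF assms(1)] embD(1)[OF assms(2)]
    by (auto simp: approx_emap)
  then show "m = n \<and> (\<forall>p < n. g (leaf p) = h (leaf p))" using mn by blast
next
  assume "m = n \<and> (\<forall>p < n. g (leaf p) = h (leaf p))"
  then show "E_approx k m (emap g) = E_approx k n (emap h)"
    by (auto simp: approx_emap restrict_map_def fun_eq_iff)
qed

text \<open>Comparing ranges gives the factorization at leaves, and commutation with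
  \<open>take\<close> carries it to their initial segments, that is, to all nodes. The factor is an
  embedding because \<open>h\<close> is injective and reflects \<open>prec\<close>.\<close>

lemma E_le_imp_factor:
  assumes g: "emb g" and h: "emb h" and le: "E_le (emap g) (emap h)"
  shows "\<exists>f. emb f \<and> emap g = emap (h \<circ> f)"
proof -
  have leaf_fac: "\<exists>l \<in> leaves. g i = h l" if "i \<in> leaves" for i
  proof -
    have "W_set k (g i) \<in> (\<lambda>l. W_set k (h l)) ` leaves"
      using le that by (auto simp: E_le_def ran_emap)
    then show ?thesis
      using W_set_eq embD(1)[OF g] embD(1)[OF h] leaf_node that by auto
  qed
  have "\<exists>l. l \<in> nodes \<and> g j = h l" if j: "j \<in> nodes" for j
  proof -
    obtain i where i: "i \<in> leaves" "prefix j i" using node_extends[OF j] .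
    obtain l where l: "l \<in> leaves" "g i = h l" using leaf_fac[OF i(1)] by blast
    have "j = take (length j) i" using i(2) by (auto simp: prefix_def)
    then have "g j = take (length j) (h l)" using embD(3)[OF g leaf_node[OF i(1)]] l(2) by metis
    also have "\<dots> = h (take (length j) l)" using embD(3)[OF h leaf_node[OF l(1)]] by simp
    finally show ?thesis using take_nondec_le[OF leaf_node[OF l(1)]] by blast
  qed
  then obtain f where f: "\<And>j. j \<in> nodes \<Longrightarrow> f j \<in> nodes \<and> g j = h (f j)" by metis
  have "emb f"
  proof (rule embI_butlast)
    fix j assume j: "j \<in> nodes"
    show "f j \<in> nodes \<and> length (f j) = length j"
      using f[OF j] embD(2)[OF g j] embD(2)[OF h, of "f j"] by simp
    have "h (f (butlast j)) = h (butlast (f j))"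
      using f[OF j] f[OF butlast_nondec_le[OF j]] emb_butlast[OF g j] emb_butlast[OF h, of "f j"] by simp
    then show "f (butlast j) = butlast (f j)"
      using emb_inj[OF h] f[OF j] f[OF butlast_nondec_le[OF j]] butlast_nondec_le by blast
  next
    fix j l assume jl: "j \<in> nodes" "l \<in> nodes" "prec j l"
    then have "prec (h (f j)) (h (f l))" using emb_prec[OF g jl] f by simp
    then show "prec (f j) (f l)" using emb_prec_iff[OF h] f jl by blast
  qed
  moreover have "emap g = emap (h \<circ> f)"
    unfolding emb_map_def using f leaf_node by (auto simp: restrict_map_def fun_eq_iff)
  ultimately show ?thesis by blast
qed

lemma E_le_factor: "emb f \<Longrightarrow> E_le (emap (h \<circ> f)) (emap h)"
  unfolding E_le_def ran_emap using emb_leaves by auto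

lemma E_le_cases:
  assumes "Y \<in> E_space k" "E_le Y (emap h)" "emb h"
  obtains f where "emb f" "Y = emap (h \<circ> f)"
proof -
  obtain g where "emb g" "Y = emap g" using assms(1) E_space_eq by auto
  then show ?thesis using E_le_imp_factor[OF _ assms(3)] assms(2) that by metis
qed

lemma emap_in: "emb g \<Longrightarrow> emap g \<in> E_space k"
  using E_space_eq by blast

definition depth :: "(nat list \<rightharpoonup> nat set) \<Rightarrow> (nat list \<rightharpoonup> nat set) \<Rightarrow> nat" where
  "depth B a = (LEAST d. ran a \<subseteq> ran (E_approx k d B))"

text \<open>The value of \<open>h \<circ> f\<close> at \<open>leaf p\<close> is the member of
  \<open>emap h\<close> with number \<open>rank (f (leaf p))\<close>. Ranks increase with
  \<open>p\<close>, so the last leaf determines the depth, which is the same as below the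
  identity.\<close>

lemma depth_eq:
  assumes h: "emb h" and f: "emb f"
  shows "depth (emap h) (E_approx k n (emap (h \<circ> f))) = rank_after f n"
proof -
  have "W_set k (h (f (leaf p))) \<in> (\<lambda>q. W_set k (h (leaf q))) ` {..<d} \<longleftrightarrow> rank (f (leaf p)) < d" for p d
  proof -
    have "W_set k (h (f (leaf p))) = W_set k (h (leaf q)) \<longleftrightarrow> rank (f (leaf p)) = q" for q
    proof -
      have "W_set k (h (f (leaf p))) = W_set k (h (leaf q)) \<longleftrightarrow> f (leaf p) = leaf q"
        using W_set_eq embD(1)[OF h] embD(1)[OF f] emb_inj[OF h] leaf_in_nodes by metis
      also have "\<dots> \<longleftrightarrow> rank (f (leaf p)) = q"
        using leaf_rank[OF emb_leaves[OF f leaf_in[of p]]] rank_leaf by metis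
      finally show ?thesis .
    qed
    then show ?thesis by (auto simp: image_iff)
  qed
  then have "ran (E_approx k n (emap (h \<circ> f))) \<subseteq> ran (E_approx k d (emap h)) \<longleftrightarrow>
      (\<forall>p < n. rank (f (leaf p)) < d)" for d
    unfolding ran_approx_emap by (simp add: image_subset_iff Ball_def)
  moreover have "(\<forall>p < n. rank (f (leaf p)) < d) \<longleftrightarrow> rank_after f n \<le> d" for d
  proof
    assume *: "\<forall>p < n. rank (f (leaf p)) < d"
    show "rank_after f n \<le> d" using * by (cases n) (auto simp: rank_after_def Suc_le_eq)
  next
    assume "rank_after f n \<le> d"
    then show "\<forall>p < n. rank (f (leaf p)) < d" using rank_less_rank_after[OF f] order_less_le_trans by blast
  qed
  ultimately show ?thesis unfolding depth_def by (simp add: Least_equality)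
qed

text \<open>Values at a node stabilize once it lies on branches where later stages agree. Each
  property of an embedding involves finitely many nodes at a time, so it is read off at one late
  stage.\<close>

lemma emb_limit:
  assumes g: "\<And>n. emb (g n)"
    and agree: "\<And>n p. p < d + n \<Longrightarrow> g (Suc n) (leaf p) = g n (leaf p)"
  shows "\<exists>h. emb h \<and> (\<forall>n. \<forall>p < d + n. h (leaf p) = g n (leaf p))"
proof -
  have stable: "g m (leaf p) = g n (leaf p)" if "n \<le> m" "p < d + n" for m n p
    using that
  proof (induction m rule: dec_induct)
    case (step m)
    then show ?case using agree[of p m] by simp
  qed simp
  have stable_node: "g m j = g n j" if "n \<le> m" "old (d + n) j" for m n j
    by (rule emb_agree[OF g g _ that(2)]) (use stable that(1) in auto)
  have "\<exists>n. old (d + n) j" if j: "j \<in> nodes" for j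
  proof -
    obtain l where l: "l \<in> leaves" "prefix j l" using node_extends[OF j] .
    then have "old (d + Suc (rank l)) j" unfolding old_def by (intro exI[of _ "rank l"]) auto
    then show ?thesis ..
  qed
  then obtain N where N: "\<And>j. j \<in> nodes \<Longrightarrow> old (d + N j) j" by metis
  define h where "h j = g (N j) j" for j
  have h: "h j = g m j" if "j \<in> nodes" "N j \<le> m" for j m
    using stable_node[OF that(2) N[OF that(1)]] by (simp add: h_def)
  have "emb h"
  proof (rule embI_butlast)
    fix j assume j: "j \<in> nodes"
    show "h j \<in> nodes \<and> length (h j) = length j" unfolding h_def using embD[OF g j] by simp
    let ?m = "max (N j) (N (butlast j))"
    show "h (butlast j) = butlast (h j)"
      using h[OF j, of ?m] h[OF butlast_nondec_le[OF j], of ?m] emb_butlast[OF g j, of ?m] by simp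
  next
    fix j l assume jl: "j \<in> nodes" "l \<in> nodes" "prec j l"
    let ?m = "max (N j) (N l)"
    show "prec (h j) (h l)"
      using h[OF jl(1), of ?m] h[OF jl(2), of ?m] emb_prec[OF g jl, of ?m] by simp
  qed
  moreover have "h (leaf p) = g n (leaf p)" if "p < d + n" for n p
    using h[of "leaf p" "max n (N (leaf p))"] stable[of n "max n (N (leaf p))" p] that by simp
  ultimately show ?thesis by blast
qed

section \<open>Verification of the axioms\<close>

abbreviation approx where "approx \<equiv> E_approx k"
abbreviation basic where "basic \<equiv> basic_set (E_space k) E_le approx"
abbreviation agreeing where "agreeing \<equiv> agreeing_below (E_space k) E_le approx"

lemma agreeing_cases:
  assumes "A \<in> agreeing d (emap h)" "emb h"
  obtains e where "emb e" "A = emap (h \<circ> e)" "\<forall>p < d. e (leaf p) = leaf p"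
proof -
  obtain e where e: "emb e" "A = emap (h \<circ> e)"
    using assms E_le_cases[of A h] by (auto simp: agreeing_below_def)
  then have "\<forall>p < d. (h \<circ> e) (leaf p) = h (leaf p)"
    using assms approx_eq_iff[OF emb_comp[OF assms(2) e(1)] assms(2)] by (auto simp: agreeing_below_def)
  then have "e (leaf p) = leaf p" if "p < d" for p
    using that emb_inj[OF assms(2) embD(1)[OF e(1) leaf_in_nodes] leaf_in_nodes] by auto
  then show ?thesis using that e by blast
qed

lemma agreeing_intro:
  assumes "emb h" "emb e" "\<forall>p < d. e (leaf p) = leaf p"
  shows "emap (h \<circ> e) \<in> agreeing d (emap h)"
proof -
  note he = emb_comp[OF assms(1,2)]
  have "E_approx k d (emap (h \<circ> e)) = E_approx k d (emap h)"
    unfolding approx_eq_iff[OF he assms(1)] using assms(3) by simp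
  then show ?thesis
    using emap_in[OF he] E_le_factor[OF assms(2), of h] by (simp add: agreeing_below_def)
qed

lemma basic_cases:
  assumes "Y \<in> basic a (emap h)" "emb h"
  obtains f n where "emb f" "Y = emap (h \<circ> f)" "a = approx n (emap (h \<circ> f))"
  using assms E_le_cases[of Y h] unfolding basic_set_def by blast

lemma basic_nonempty_cases:
  assumes "basic a (emap h) \<noteq> {}" "emb h"
  obtains f n where "emb f" "a = approx n (emap (h \<circ> f))"
  using assms basic_cases by blast

text \<open>Cancelling the injective \<open>h\<close> leads to the situation of
  \<open>emb_amalgamation\<close> and \<open>emb_pigeonhole\<close>.\<close>

lemma basic_approx_cases:
  assumes "Y \<in> basic (approx n (emap (h \<circ> f))) (emap (h \<circ> e))" "emb h" "emb f" "emb e"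
  obtains u where "emb u" "Y = emap (h \<circ> (e \<circ> u))" "\<forall>p < n. e (u (leaf p)) = f (leaf p)"
proof -
  note he = emb_comp[OF assms(2,4)]
  obtain u m where u: "emb u" "Y = emap (h \<circ> e \<circ> u)"
      "approx n (emap (h \<circ> f)) = approx m (emap (h \<circ> e \<circ> u))"
    using basic_cases[OF assms(1) he] .
  then have "\<forall>p < n. h (f (leaf p)) = h (e (u (leaf p)))"
    using approx_eq_iff[OF emb_comp[OF assms(2,3)] emb_comp[OF he u(1)], of n m] by simp
  then have "\<forall>p < n. e (u (leaf p)) = f (leaf p)"
    using emb_inj[OF assms(2)] embD(1) assms(3,4) u(1) leaf_in_nodes by metis
  then show ?thesis using that u(1,2) by (simp add: comp_assoc)
qed

lemma approximation_space_E_space: "approximation_space (E_space k) E_le approx depth"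
proof unfold_locales
  show "E_le A A" for A by (simp add: E_le_def)
  show "E_le A B \<Longrightarrow> E_le B C \<Longrightarrow> E_le A C" for A B C by (auto simp: E_le_def)
  show "m = n" if "A \<in> E_space k" "B \<in> E_space k" "approx m A = approx n B" for A B m n
    using that approx_eq_iff by (auto simp: E_space_eq)
  show "approx m A = approx m B"
    if "A \<in> E_space k" "B \<in> E_space k" "approx n A = approx n B" "m \<le> n" for A B m n
    using that by (auto simp: E_space_eq approx_eq_iff)
next
  fix B d assume "B \<in> E_space k"
  then obtain h where h: "emb h" "B = emap h" by (auto simp: E_space_eq)
  let ?S = "(\<lambda>p. W_set k (h (leaf p))) ` {..<d}"
  \<comment> \<open>An \<open>a\<close> of depth \<open>d\<close> is a finite map on the first
    \<open>n \<le> d\<close> leaves with values among the first \<open>d\<close> members of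
    \<open>B\<close>.\<close>
  have "{a. basic a B \<noteq> {} \<and> depth B a = d} \<subseteq>
      (\<Union>n \<le> d. {a. dom a = leaf ` {..<n} \<and> ran a \<subseteq> ?S})"
  proof
    fix a assume "a \<in> {a. basic a B \<noteq> {} \<and> depth B a = d}"
    then have a: "basic a (emap h) \<noteq> {}" "depth (emap h) a = d" using h by auto
    obtain f n where f: "emb f" "a = approx n (emap (h \<circ> f))" using basic_nonempty_cases[OF a(1) h(1)] .
    have d: "d = rank_after f n" using depth_eq[OF h(1) f(1)] a(2) f(2) by simp
    have "n \<le> rank_after f n" for n
    proof (induction n)
      case (Suc n)
      then show ?case using rank_after_less[OF f(1), of n "Suc n"] by simp
    qed simp
    then have "n \<le> d" using d by simp
    moreover have "ran a \<subseteq> ?S"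
    proof -
      have "W_set k (h (f (leaf p))) \<in> ?S" if "p < n" for p
        using rank_less_rank_after[OF f(1) that] d leaf_rank[OF emb_leaves[OF f(1) leaf_in[of p]]]
        by (intro image_eqI[of _ _ "rank (f (leaf p))"]) auto
      then show ?thesis unfolding f(2) ran_approx_emap by auto
    qed
    ultimately show "a \<in> (\<Union>n \<le> d. {a. dom a = leaf ` {..<n} \<and> ran a \<subseteq> ?S})"
      using dom_approx_emap f(2) by auto
  qed
  moreover have "finite (\<Union>n \<le> d. {a. dom a = leaf ` {..<n} \<and> ran a \<subseteq> ?S})"
    by (intro finite_UN_I finite_set_of_finite_maps) auto
  ultimately show "finite {a. basic a B \<noteq> {} \<and> depth B a = d}" by (rule finite_subset)
next
  fix A B m n assume *: "A \<in> E_space k" "B \<in> E_space k" "E_le A B" and mn: "(m::nat) < n"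
  from *(2) obtain h where h: "emb h" "B = emap h" by (auto simp: E_space_eq)
  obtain f where f: "emb f" "A = emap (h \<circ> f)" using E_le_cases[OF *(1) *(3)[unfolded h(2)] h(1)] .
  show "depth B (approx m A) < depth B (approx n A)"
    unfolding f(2) h(2) depth_eq[OF h(1) f(1)] using rank_after_less[OF f(1) mn] .
next
  fix A B a assume *: "B \<in> E_space k" "basic a B \<noteq> {}" "A \<in> agreeing (depth B a) B"
  from *(1) obtain h where h: "emb h" "B = emap h" by (auto simp: E_space_eq)
  obtain f n where f: "emb f" "a = approx n (emap (h \<circ> f))"
    using basic_nonempty_cases[OF *(2)[unfolded h(2)] h(1)] .
  have dep: "depth B a = rank_after f n" unfolding h(2) f(2) by (rule depth_eq[OF h(1) f(1)])
  obtain e where e: "emb e" "A = emap (h \<circ> e)" "\<forall>p < rank_after f n. e (leaf p) = leaf p"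
    using agreeing_cases[OF *(3)[unfolded dep, unfolded h(2)] h(1)] .
  have hef: "emb (h \<circ> e \<circ> f)" using emb_comp h(1) e(1) f(1) by simp
  \<comment> \<open>\<open>e\<close> moves none of the leaves \<open>f (leaf p)\<close> with
    \<open>p < n\<close>, so inserting it leaves the approximation unchanged.\<close>
  have "approx n (emap (h \<circ> e \<circ> f)) = a"
    unfolding f(2) approx_eq_iff[OF hef emb_comp[OF h(1) f(1)]]
    using fix_leaf_below[OF f(1) e(3)] by simp
  then have "emap (h \<circ> e \<circ> f) \<in> basic a A"
    using emap_in[OF hef] E_le_factor[OF f(1), of "h \<circ> e"] e(2) by (auto simp: basic_set_def)
  then show "basic a A \<noteq> {}" by blast
next
  fix A B a d
  assume *: "B \<in> E_space k" "A \<in> agreeing d B" "basic a A \<noteq> {}" "depth A a \<le> d \<or> depth B a \<le> d"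
  from *(1) obtain h where h: "emb h" "B = emap h" by (auto simp: E_space_eq)
  obtain e where e: "emb e" "A = emap (h \<circ> e)" "\<forall>p < d. e (leaf p) = leaf p"
    using agreeing_cases[OF *(2)[unfolded h(2)] h(1)] .
  note he = emb_comp[OF h(1) e(1)]
  obtain f n where f: "emb f" "a = approx n (emap (h \<circ> e \<circ> f))"
    using basic_nonempty_cases[OF *(3)[unfolded e(2)] he] .
  have dA: "depth A a = rank_after f n" unfolding e(2) f(2) by (rule depth_eq[OF he f(1)])
  have dB: "depth B a = rank_after (e \<circ> f) n"
    unfolding h(2) f(2) comp_assoc by (rule depth_eq[OF h(1) emb_comp[OF e(1) f(1)]])
  show "depth B a = depth A a"
  proof (cases n)
    case 0
    then show ?thesis unfolding dA dB by (simp add: rank_after_def)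
  next
    case (Suc m)
    let ?q = "f (leaf m)"
    have lq: "leaf (rank ?q) = ?q" "leaf (rank (e ?q)) = e ?q"
      using emb_leaves[OF f(1) leaf_in[of m]] emb_leaves[OF e(1)] by auto
    \<comment> \<open>The depths are the ranks of \<open>e ?q\<close> and \<open>?q\<close> plus
      one. If \<open>e ?q\<close> has rank below \<open>d\<close>, then \<open>e\<close> fixes it,
      and injectivity gives the equality.\<close>
    have "e ?q = ?q"
    proof (cases "rank ?q < d")
      case True
      then show ?thesis using e(3)[rule_format, OF True] lq by simp
    next
      case False
      then have "rank (e ?q) < d" using *(4) Suc unfolding dA dB by (simp add: rank_after_def)
      then have "e (e ?q) = e ?q" using e(3)[rule_format, of "rank (e ?q)"] lq by simp
      moreover have "?q \<in> nodes" "e ?q \<in> nodes"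
        using embD(1)[OF f(1) leaf_in_nodes] embD(1)[OF e(1)] by auto
      ultimately show ?thesis using emb_inj[OF e(1)] by blast
    qed
    then show ?thesis unfolding dA dB Suc by (simp add: rank_after_def)
  qed
next
  fix A B a assume *: "B \<in> E_space k" "A \<in> E_space k" "E_le A B" "basic a A \<noteq> {}"
  from *(1) obtain h where h: "emb h" "B = emap h" by (auto simp: E_space_eq)
  obtain Y n where Y: "Y \<in> E_space k" "E_le Y A" "a = approx n Y" using *(4) by (auto simp: basic_set_def)
  then have "E_le Y (emap h)" using *(3) h(2) by (auto simp: E_le_def)
  then obtain f where f: "emb f" "Y = emap (h \<circ> f)" using E_le_cases[OF Y(1) _ h(1)] by blast
  obtain e where e: "emb e" "\<forall>p < rank_after f n. e (leaf p) = leaf p"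
    and ran: "\<And>u l. emb u \<Longrightarrow> \<forall>p < n. e (u (leaf p)) = f (leaf p) \<Longrightarrow> l \<in> nodes \<Longrightarrow> e (u l) \<in> f ` nodes"
    using emb_amalgamation[OF f(1), of n] by blast
  have dep: "depth B a = rank_after f n" unfolding h(2) f(2) Y(3) by (rule depth_eq[OF h(1) f(1)])
  have "Z \<in> basic a A" if Z: "Z \<in> basic a (emap (h \<circ> e))" for Z
  proof -
    obtain u where u: "emb u" "Z = emap (h \<circ> (e \<circ> u))" "\<forall>p < n. e (u (leaf p)) = f (leaf p)"
      using basic_approx_cases[OF Z[unfolded Y(3) f(2)] h(1) f(1) e(1)] .
    \<comment> \<open>\<open>f\<close> preserves length, so the node sent to \<open>e (u l)\<close>
      is a leaf; hence \<open>Z\<close> lies below \<open>Y\<close>.\<close>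
    have "e (u l) \<in> f ` leaves" if l: "l \<in> leaves" for l
    proof -
      obtain j where j: "j \<in> nodes" "e (u l) = f j" using ran[OF u(1,3) leaf_node[OF l]] by blast
      have "e (u l) \<in> leaves" using emb_leaves e(1) u(1) l by blast
      then have "j \<in> leaves" using j embD(2)[OF f(1) j(1)] by (simp add: leaves_iff)
      then show ?thesis using j by blast
    qed
    then have "E_le Z Y" unfolding u(2) f(2) E_le_def ran_emap by fastforce
    then have "E_le Z A" using Y(2) by (auto simp: E_le_def)
    then show ?thesis using Z by (auto simp: basic_set_def)
  qed
  then show "\<exists>A' \<in> agreeing (depth B a) B. basic a A' \<subseteq> basic a A"
    using agreeing_intro[OF h(1) e] unfolding dep unfolding h(2) by blast
next
  fix A B n O' assume *: "B \<in> E_space k" "A \<in> E_space k" "E_le A B"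
  from *(1) obtain h where h: "emb h" "B = emap h" by (auto simp: E_space_eq)
  obtain f where f: "emb f" "A = emap (h \<circ> f)" using E_le_cases[OF *(2) *(3)[unfolded h(2)] h(1)] .
  \<comment> \<open>A one-step extension of \<open>approx n A\<close> is determined by the leaf
    \<open>w\<close> whose image under \<open>h\<close> is added, so colouring approximations
    amounts to colouring leaves.\<close>
  let ?Q = "\<lambda>w. (approx n A)(leaf n \<mapsto> W_set k (h w)) \<in> O'"
  obtain e b where e: "emb e" "\<forall>p < rank_after f n. e (leaf p) = leaf p"
    and b: "\<forall>u. emb u \<and> (\<forall>p < n. e (u (leaf p)) = f (leaf p)) \<longrightarrow> ?Q (e (u (leaf n))) = b"
    using emb_pigeonhole[OF f(1), of n ?Q] by (elim exE conjE)
  have dep: "depth B (approx n A) = rank_after f n" unfolding h(2) f(2) by (rule depth_eq[OF h(1) f(1)])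
  have "approx (Suc n) Y \<in> O' \<longleftrightarrow> b" if Y: "Y \<in> basic (approx n A) (emap (h \<circ> e))" for Y
  proof -
    obtain u where u: "emb u" "Y = emap (h \<circ> (e \<circ> u))" "\<forall>p < n. e (u (leaf p)) = f (leaf p)"
      using basic_approx_cases[OF Y[unfolded f(2)] h(1) f(1) e(1)] .
    have "approx (Suc n) Y = (approx n A)(leaf n \<mapsto> W_set k (h (e (u (leaf n)))))"
      unfolding u(2) f(2) approx_emap using u(3)
      by (auto simp: fun_eq_iff restrict_map_def lessThan_Suc)
    then show ?thesis using b[rule_format, OF conjI[OF u(1,3)]] by simp
  qed
  then show "\<exists>C \<in> agreeing (depth B (approx n A)) B.
      (\<forall>Y \<in> basic (approx n A) C. approx (Suc n) Y \<in> O') \<or>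
      (\<forall>Y \<in> basic (approx n A) C. approx (Suc n) Y \<notin> O')"
    using agreeing_intro[OF h(1) e] unfolding dep unfolding h(2) by blast
next
  fix S :: "nat \<Rightarrow> nat list \<rightharpoonup> nat set" and d
  assume S: "\<And>n. S n \<in> E_space k" and agree: "\<And>n. S (Suc n) \<in> agreeing (d + n) (S n)"
  have "\<forall>n. \<exists>g. emb g \<and> S n = emap g" using S by (auto simp: E_space_eq)
  then obtain g where g: "\<And>n. emb (g n)" "\<And>n. S n = emap (g n)" by metis
  have eq: "g (Suc n) (leaf p) = g n (leaf p)" if "p < d + n" for n p
    using agree[of n] that approx_eq_iff[OF g(1) g(1), of "d + n" "Suc n" "d + n" n]
    by (auto simp: agreeing_below_def g(2))
  obtain h where h: "emb h" "\<And>n p. p < d + n \<Longrightarrow> h (leaf p) = g n (leaf p)"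
    using emb_limit[of g d] g(1) eq by blast
  have mono: "ran (S m) \<subseteq> ran (S n)" if "n \<le> m" for n m
    using that
  proof (induction m rule: dec_induct)
    case (step m)
    then show ?case using agree[of m] by (auto simp: agreeing_below_def E_le_def)
  qed simp
  have "E_le (emap h) (S n)" for n
    unfolding E_le_def
  proof
    fix w assume "w \<in> ran (emap h)"
    then obtain l where l: "l \<in> leaves" "w = W_set k (h l)" by (auto simp: ran_emap)
    \<comment> \<open>At this stage the value at \<open>l\<close> has stabilized, and ranges
      decrease along the stages.\<close>
    let ?m = "max n (Suc (rank l))"
    have "h l = g ?m l" using h(2)[of "rank l" ?m] leaf_rank[OF l(1)] by simp
    then have "w \<in> ran (S ?m)" using l by (auto simp: g(2) ran_emap)
    then show "w \<in> ran (S n)" using mono[of n ?m] by auto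
  qed
  moreover have "approx (d + n) (emap h) = approx (d + n) (S n)" for n
    unfolding g(2) approx_eq_iff[OF h(1) g(1)] using h(2) by simp
  ultimately show "\<exists>C. \<forall>n. C \<in> agreeing (d + n) (S n)"
    using emap_in[OF h(1)] by (auto simp: agreeing_below_def)
qed

end

theorem theorem21:
  fixes k :: nat
  assumes "2 \<le> k"
  shows "topological_ramsey_space (E_space k) E_le (E_approx k)"
proof -
  interpret nondec_tree k using assms by unfold_locales simp
  show ?thesis
    by (rule approximation_space.topological_ramsey_space[OF approximation_space_E_space])
qed

end
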